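(* Let $X$ be a separable, commutative $F$-algebra over the real or complex scalar field $\mathbb{K}$ that supports a dense freely generated subalgebra. Then for any operator $T$ on $X$ that is both weakly mixing and multiplicative, the following are equivalent: (a) The operator $T$ supports a hypercyclic algebra. (b) For each non-zero polynomial $P$ in one variable with coefficients in $\mathbb{K}$ and $P(0)=0$, the map $\widehat{P}:X\to X$, $f\mapsto P(f)$, has dense range. (c) For each $N\ge2$ and each non-zero polynomial $P$ in $N$ variables with coefficients in $\mathbb{K}$ and $P(0)=0$, the map $\widehat{P}:X^N\to X$, $f\mapsto P(f)$, has dense range. (d) The set of hypercyclic vectors for $T$ is densely strongly algebrable. Moreover, the set of $f\in X^{\mathbb{N}}$ that freely generate a dense hypercyclic algebra for $T$ is residual in $X^{\mathbb{N}}$. In particular, either every weakly mixing multiplicative operator on $X$ supports a dense hypercyclic algebra that is not finitely generated, or else no such operator supports a hypercyclic algebra.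
   Context: An $F$-algebra is a metrizable and complete topological algebra. An operator on $X$ is a continuous linear map $T:X\to X$; it is multiplicative if $T(fg)=T(f)T(g)$ for all $f,g\in X$, and weakly mixing if $T\oplus T$ is hypercyclic on $X\times X$. A vector $f$ is hypercyclic for $T$ if $\{f,Tf,T^2f,\dots\}$ is dense in $X$; $T$ is hypercyclic if it has a hypercyclic vector. A hypercyclic algebra for $T$ is a nonzero subalgebra of $X$ all of whose nonzero elements are hypercyclic for $T$; $T$ supports a hypercyclic algebra if such an algebra exists. Subalgebras are not required to contain a unit. Powers of $X$ carry the product topology. A set $Y\subset X$ is algebraically independent if for any pairwise distinct $y_1,\dots,y_n\in Y$ and any nonzero $P\in\mathbb{K}[t_1,\dots,t_n]$ with $P(0)=0$ one has $P(y_1,\dots,y_n)\ne0$. $A(Y)=\{P(y_1,\dots,y_n): n\in\mathbb{N}, y_i\in Y, P\in\mathbb{K}[t_1,\dots,t_n], P(0)=0\}$ is the subalgebra generated by $Y$, and, if $X$ has a unit, $A_1(Y)$ (same definition without the requirement $P(0)=0$) is the unital subalgebra generated by $Y$. "$X$ supports a dense freely generated subalgebra" means: there is a nonempty algebraically independent set $Y\subset X$ such that $A(Y)$ is dense in $X$ when $X$ has no unit, respectively such that $A_1(Y)$ is dense in $X$ when $X$ has a unit. A sequence $f=(f_j)_{j\ge1}\in X^{\mathbb{N}}$ freely generates a dense hypercyclic algebra for $T$ if $P(f_1,\dots,f_n)\ne0$ for all $n\in\mathbb{N}$ and all nonzero $P\in\mathbb{K}[t_1,\dots,t_n]$ with $P(0)=0$,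 and the subalgebra $A(f)$ generated by $\{f_j:j\geq 1\}$ is dense in $X$ and is a hypercyclic algebra for $T$. A subset $E\subset X$ is densely strongly algebrable if $E\cup\{0\}$ contains a dense subalgebra of $X$ of the form $A(Y)$ with $Y$ an infinite algebraically independent set. *)

theory Defs
  imports
    "HOL-Analysis.Analysis"
    "HOL-Computational_Algebra.Polynomial"
    "HOL-Library.Poly_Mapping"
begin

text \<open>
  By Frobenius' theorem the reals and the complex numbers are, up to isomorphism and
  homeomorphism, the only members of the following class.
\<close>

class real_or_complex_field = real_normed_field + euclidean_space

instance real :: real_or_complex_field ..
instance complex :: real_or_complex_field ..

text \<open>
  The distribution has no complex vector space class, so scalar multiplication is an explicit
  operation. The class \<open>uniform_topological_group_add\<close> forces the uniformity of the metric
  to be the uniformity of the additive topological group; hence completeness of the metric is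
  completeness of the topological vector space. Conversely, a metrizable complete topological
  vector space has a translation-invariant complete metric, and such a metric satisfies these
  class axioms. A multiplicative unit is not required (\<open>comm_ring\<close>, not \<open>comm_ring_1\<close>).
\<close>

locale comm_F_algebra = vector_space smul
  for smul :: "'k::real_or_complex_field \<Rightarrow>
      'a::{comm_ring, topological_semigroup_mult, uniform_topological_group_add, complete_space} \<Rightarrow> 'a" +
  assumes smul_mult_left: "smul c (x * y) = smul c x * y"
    and continuous_smul: "continuous_on UNIV (\<lambda>(c, x). smul c x)"

definition subalgebra :: "('k::field \<Rightarrow> 'a::comm_ring \<Rightarrow> 'a) \<Rightarrow> 'a set \<Rightarrow> bool" where
  "subalgebra smul A \<longleftrightarrow> module.subspace smul A \<and> (\<forall>x\<in>A. \<forall>y\<in>A. x * y \<in> A)"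

definition is_unit_elt :: "'a::comm_ring \<Rightarrow> bool" where
  "is_unit_elt e \<longleftrightarrow> (\<forall>x. e * x = x)"

text \<open>Product of a nonempty list; the value on the empty list is never used.\<close>

definition list_product :: "'a::semigroup_mult list \<Rightarrow> 'a" where
  "list_product xs = foldl (*) (hd xs) (tl xs)"

text \<open>
  Both evaluations omit the constant term, so they give $P(f)$ and $P(y)$ when $P(0) = 0$.
\<close>

definition eval_poly1 :: "('k::field \<Rightarrow> 'a::comm_ring \<Rightarrow> 'a) \<Rightarrow> 'k poly \<Rightarrow> 'a \<Rightarrow> 'a" where
  "eval_poly1 smul P f = (\<Sum>i=1..degree P. smul (coeff P i) (list_product (replicate i f)))"

text \<open>
  A polynomial in the variables $t_0, t_1, \dots$ is a finitely supported map from monomials to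
  coefficients; a monomial is a finitely supported map from variable indices to exponents.
\<close>

type_synonym 'k multipoly = "(nat \<Rightarrow>\<^sub>0 nat) \<Rightarrow>\<^sub>0 'k"

definition polys_in :: "nat \<Rightarrow> 'k::zero multipoly set" where
  "polys_in n = {P. \<forall>m\<in>Poly_Mapping.keys P. Poly_Mapping.keys m \<subseteq> {..<n}}"

abbreviation const_term :: "'k::zero multipoly \<Rightarrow> 'k" where
  "const_term P \<equiv> Poly_Mapping.lookup P 0"

definition eval_monomial :: "(nat \<Rightarrow> 'a::comm_ring) \<Rightarrow> (nat \<Rightarrow>\<^sub>0 nat) \<Rightarrow> 'a" where
  "eval_monomial y m = list_product
     (concat (map (\<lambda>i. replicate (Poly_Mapping.lookup m i) (y i))
                  (sorted_list_of_set (Poly_Mapping.keys m))))"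

definition eval_poly ::
    "('k::field \<Rightarrow> 'a::comm_ring \<Rightarrow> 'a) \<Rightarrow> 'k multipoly \<Rightarrow> (nat \<Rightarrow> 'a) \<Rightarrow> 'a" where
  "eval_poly smul P y =
     (\<Sum>m\<in>Poly_Mapping.keys P - {0}. smul (Poly_Mapping.lookup P m) (eval_monomial y m))"

definition algebraically_independent ::
    "('k::field \<Rightarrow> 'a::comm_ring \<Rightarrow> 'a) \<Rightarrow> 'a set \<Rightarrow> bool" where
  "algebraically_independent smul Y \<longleftrightarrow>
     (\<forall>n y P. inj_on y {..<n} \<and> y ` {..<n} \<subseteq> Y \<and>
        P \<in> polys_in n \<and> P \<noteq> 0 \<and> const_term P = 0 \<longrightarrow> eval_poly smul P y \<noteq> 0)"

definition alg_generated :: "('k::field \<Rightarrow> 'a::comm_ring \<Rightarrow> 'a) \<Rightarrow> 'a set \<Rightarrow> 'a set" where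
  "alg_generated smul Y =
     {eval_poly smul P y | n y P. y ` {..<n} \<subseteq> Y \<and> P \<in> polys_in n \<and> const_term P = 0}"

definition unital_alg_generated ::
    "('k::field \<Rightarrow> 'a::comm_ring \<Rightarrow> 'a) \<Rightarrow> 'a \<Rightarrow> 'a set \<Rightarrow> 'a set" where
  "unital_alg_generated smul e Y =
     {smul (const_term P) e + eval_poly smul P y | n y P. y ` {..<n} \<subseteq> Y \<and> P \<in> polys_in n}"

definition supports_dense_freely_generated_subalgebra ::
    "('k::field \<Rightarrow> 'a::{comm_ring, topological_space} \<Rightarrow> 'a) \<Rightarrow> bool" where
  "supports_dense_freely_generated_subalgebra smul \<longleftrightarrow>
     (\<exists>Y. Y \<noteq> {} \<and> algebraically_independent smul Y \<and>
        ((\<nexists>e::'a. is_unit_elt e) \<longrightarrow> closure (alg_generated smul Y) = UNIV) \<and>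
        (\<forall>e. is_unit_elt e \<longrightarrow> closure (unital_alg_generated smul e Y) = UNIV))"

definition operator :: "('k::field \<Rightarrow> 'a::{comm_ring, topological_space} \<Rightarrow> 'a) \<Rightarrow> ('a \<Rightarrow> 'a) \<Rightarrow> bool" where
  "operator smul T \<longleftrightarrow> Vector_Spaces.linear smul smul T \<and> continuous_on UNIV T"

definition multiplicative :: "('a::comm_ring \<Rightarrow> 'a) \<Rightarrow> bool" where
  "multiplicative T \<longleftrightarrow> (\<forall>f g. T (f * g) = T f * T g)"

definition hypercyclic_vector :: "('b::topological_space \<Rightarrow> 'b) \<Rightarrow> 'b \<Rightarrow> bool" where
  "hypercyclic_vector T f \<longleftrightarrow> closure (range (\<lambda>n. (T ^^ n) f)) = UNIV"

definition hypercyclic :: "('b::topological_space \<Rightarrow> 'b) \<Rightarrow> bool" where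
  "hypercyclic T \<longleftrightarrow> (\<exists>f. hypercyclic_vector T f)"

definition weakly_mixing :: "('b::topological_space \<Rightarrow> 'b) \<Rightarrow> bool" where
  "weakly_mixing T \<longleftrightarrow> hypercyclic (map_prod T T)"

definition hypercyclic_algebra ::
    "('k::field \<Rightarrow> 'a::{comm_ring, topological_space} \<Rightarrow> 'a) \<Rightarrow> ('a \<Rightarrow> 'a) \<Rightarrow> 'a set \<Rightarrow> bool" where
  "hypercyclic_algebra smul T A \<longleftrightarrow>
     subalgebra smul A \<and> A \<noteq> {0} \<and> (\<forall>f\<in>A - {0}. hypercyclic_vector T f)"

definition supports_hypercyclic_algebra ::
    "('k::field \<Rightarrow> 'a::{comm_ring, topological_space} \<Rightarrow> 'a) \<Rightarrow> ('a \<Rightarrow> 'a) \<Rightarrow> bool" where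
  "supports_hypercyclic_algebra smul T \<longleftrightarrow> (\<exists>A. hypercyclic_algebra smul T A)"

definition finitely_generated ::
    "('k::field \<Rightarrow> 'a::comm_ring \<Rightarrow> 'a) \<Rightarrow> 'a set \<Rightarrow> bool" where
  "finitely_generated smul A \<longleftrightarrow> (\<exists>Y. finite Y \<and> A = alg_generated smul Y)"

definition densely_strongly_algebrable ::
    "('k::field \<Rightarrow> 'a::{comm_ring, topological_space} \<Rightarrow> 'a) \<Rightarrow> 'a set \<Rightarrow> bool" where
  "densely_strongly_algebrable smul E \<longleftrightarrow>
     (\<exists>Y. infinite Y \<and> algebraically_independent smul Y \<and>
        closure (alg_generated smul Y) = UNIV \<and> alg_generated smul Y \<subseteq> E \<union> {0})"

definition freely_generates_dense_hypercyclic_algebra ::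
    "('k::field \<Rightarrow> 'a::{comm_ring, topological_space} \<Rightarrow> 'a) \<Rightarrow> ('a \<Rightarrow> 'a) \<Rightarrow> (nat \<Rightarrow> 'a) \<Rightarrow> bool" where
  "freely_generates_dense_hypercyclic_algebra smul T f \<longleftrightarrow>
     (\<forall>n. \<forall>P\<in>polys_in n. P \<noteq> 0 \<and> const_term P = 0 \<longrightarrow> eval_poly smul P f \<noteq> 0) \<and>
     closure (alg_generated smul (range f)) = UNIV \<and>
     hypercyclic_algebra smul T (alg_generated smul (range f))"

text \<open>Equivalently, the complement of $S$ is a countable union of nowhere dense sets.\<close>

definition residual :: "'b::topological_space set \<Rightarrow> bool" where
  "residual S \<longleftrightarrow>
     (\<exists>U::nat \<Rightarrow> 'b set. (\<forall>n. open (U n) \<and> closure (U n) = UNIV) \<and> (\<Inter>n. U n) \<subseteq> S)"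

end

theory Submission
  imports Defs
begin

text \<open>
  Everything rests on one observation. A multiplicative linear map satisfies $T(P(f)) = P(Tf)$ for every
  polynomial $P$ without constant term, so $f \mapsto P(f)$ is a quasi-conjugacy from the coordinatewise
  action of $T$ on sequences to $T$ as soon as it has dense range. Hence, if all polynomial maps have
  dense range, every sequence $f$ with dense orbit under the coordinatewise action has hypercyclic
  values $P(f)$ for all nonzero $P$ simultaneously (\<open>hypercyclic_poly_value\<close>). In particular these
  values are nonzero, so that $f$ is algebraically independent and freely generates a hypercyclic algebra.

  Such sequences are generic: weak mixing passes from $T \times T$ to all finite powers by
  Furstenberg's intersection argument (\<open>simultaneous_return\<close>), hence to the sequence space, whose
  topology sees only finitely many coordinates at a time; Birkhoff's transitivity theorem then gives
  a residual set (\<open>residual_hypercyclic_sequences\<close>). A generic sequence is also dense as a subset of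
  $X$, which makes the generated algebra dense, and by Baire's theorem generic sequences exist. A freely
  generated algebra with infinitely many generators is not finitely generated.

  Conversely, a hypercyclic algebra contains a hypercyclic $f$ all of whose polynomial values remain in it. If
  $P(f) \ne 0$, its orbit lies in the range of $P$, which is thus dense. The alternative $P(f) = 0$
  would make $P$ vanish identically on $X$, which the presence of one algebraically independent
  element excludes (\<open>hypercyclic_algebra_imp_dense_range\<close>).

  Finally, several variables reduce to one by Kronecker's substitution $t_i \mapsto t^{B^i}$
  (\<open>dense_range_univariate_imp_multivariate\<close>), and one variable is the case of polynomials in two
  variables in which only the first occurs.
\<close>

section \<open>Products and monomials without a unit\<close>

lemma list_product_Cons:
  "xs \<noteq> [] \<Longrightarrow> list_product (x # xs) = x * list_product xs"
proof (induction xs rule: rev_induct)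
  case (snoc y ys)
  then show ?case by (cases "ys = []") (simp_all add: list_product_def mult.assoc)
qed simp

lemma list_product_single [simp]: "list_product [x] = x"
  by (simp add: list_product_def)

lemma list_product_append:
  assumes "xs \<noteq> []" "ys \<noteq> []"
  shows "list_product (xs @ ys) = list_product xs * list_product ys"
  using assms(1)
proof (induction xs)
  case (Cons x xs)
  then show ?case using assms(2)
    by (cases "xs = []") (simp_all add: list_product_Cons mult.assoc)
qed simp

text \<open>
  Without a unit there is no product over an arbitrary finite multiset; for nonempty lists, this
  invariance under rearrangement takes its place.
\<close>

lemma list_product_mset_cong:
  fixes xs ys :: "'a::comm_ring list"
  assumes "mset xs = mset ys"
  shows "list_product xs = list_product ys"
  using assms
proof (induction xs arbitrary: ys)
  case (Cons x xs)
  then have "x \<in> set ys"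
    by (metis list.set_intros(1) set_mset_mset)
  then obtain us vs where ys: "ys = us @ x # vs"
    by (meson split_list)
  have mset: "mset xs = mset (us @ vs)"
    using Cons.prems ys by simp
  have move: "list_product (us @ x # vs) = x * list_product (us @ vs)" if "us @ vs \<noteq> []"
  proof (cases "us = [] \<or> vs = []")
    case False
    then show ?thesis
      by (simp add: list_product_append list_product_Cons mult.left_commute)
  next
    case True
    then show ?thesis using that
      by (auto simp: list_product_append list_product_Cons mult.commute)
  qed
  show ?case
  proof (cases "xs = []")
    case True
    then show ?thesis using mset ys by simp
  next
    case False
    then have "us @ vs \<noteq> []" using mset by auto
    then show ?thesis
      using Cons.IH[OF mset] move False ys by (simp add: list_product_Cons)
  qed
qed simp

lemma list_product_map_hom:
  assumes "\<And>x y. h (x * y) = h x * h y" "xs \<noteq> []"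
  shows "h (list_product xs) = list_product (map h xs)"
  using assms(2)
proof (induction xs)
  case (Cons x xs)
  then show ?case by (cases "xs = []") (simp_all add: list_product_Cons assms(1))
qed simp

text \<open>
  Listing the variables of a monomial with multiplicity, independently of the point of evaluation,
  reduces statements on values of monomials to statements on products of mapped lists.
\<close>

definition monomial_vars :: "(nat \<Rightarrow>\<^sub>0 nat) \<Rightarrow> nat list" where
  "monomial_vars m = concat (map (\<lambda>i. replicate (Poly_Mapping.lookup m i) i)
                  (sorted_list_of_set (Poly_Mapping.keys m)))"

lemma eval_monomial_vars: "eval_monomial y m = list_product (map y (monomial_vars m))"
  by (simp add: eval_monomial_def monomial_vars_def map_concat comp_def)

lemma count_monomial_vars: "count (mset (monomial_vars m)) i = Poly_Mapping.lookup m i"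
proof -
  have "count (mset (concat (map (\<lambda>i. replicate (Poly_Mapping.lookup m i) i) js))) i
      = (if i \<in> set js then Poly_Mapping.lookup m i else 0)" if "distinct js" for js
    using that by (induction js) auto
  then show ?thesis
    by (simp add: monomial_vars_def in_keys_iff)
qed

lemma set_monomial_vars [simp]: "set (monomial_vars m) = Poly_Mapping.keys m"
  by (auto simp: monomial_vars_def in_keys_iff)

lemma monomial_vars_eq_Nil [simp]: "monomial_vars m = [] \<longleftrightarrow> m = 0"
  by (metis keys_eq_empty set_empty set_monomial_vars)

text \<open>
  Both monomials have to be nontrivial: the empty monomial has no meaningful value in an algebra
  without unit.
\<close>

lemma eval_monomial_add:
  assumes "m \<noteq> 0" "m' \<noteq> 0"
  shows "eval_monomial y (m + m') = eval_monomial y m * eval_monomial y m'"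
proof -
  have "mset (monomial_vars (m + m')) = mset (monomial_vars m @ monomial_vars m')"
    by (rule multiset_eqI) (simp only: mset_append count_union count_monomial_vars lookup_add)
  then have "mset (map y (monomial_vars (m + m'))) = mset (map y (monomial_vars m @ monomial_vars m'))"
    by (simp only: mset_map)
  then have "eval_monomial y (m + m') = list_product (map y (monomial_vars m @ monomial_vars m'))"
    unfolding eval_monomial_vars by (rule list_product_mset_cong)
  then show ?thesis
    using assms by (simp add: eval_monomial_vars list_product_append)
qed

lemma eval_monomial_single:
  assumes "k > 0"
  shows "eval_monomial y (Poly_Mapping.single i k) = list_product (replicate k (y i))"
  using assms by (simp add: eval_monomial_def)

lemma eval_monomial_cong:
  assumes "\<And>i. i \<in> Poly_Mapping.keys m \<Longrightarrow> y i = z i"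
  shows "eval_monomial y m = eval_monomial z m"
  unfolding eval_monomial_vars using assms by (metis map_cong set_monomial_vars)

lemma eval_monomial_hom:
  assumes "\<And>x y. h (x * y) = h x * h y" "m \<noteq> 0"
  shows "h (eval_monomial y m) = eval_monomial (h \<circ> y) m"
  using assms by (simp add: eval_monomial_vars list_product_map_hom)

lemma list_product_in:
  assumes "\<And>x y. x \<in> A \<Longrightarrow> y \<in> A \<Longrightarrow> x * y \<in> A" "xs \<noteq> []" "set xs \<subseteq> A"
  shows "list_product xs \<in> A"
  using assms(2,3)
proof (induction xs)
  case (Cons x xs)
  then show ?case by (cases "xs = []") (simp_all add: list_product_Cons assms(1))
qed simp

text \<open>
  Substituting the power $t^{g(j)}$ for the variable $j$ turns a monomial into the power of $t$
  whose exponent is the $g$-weighted degree. This is the substitution used to pass from several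
  variables to one.
\<close>

lemma list_product_powers:
  fixes t :: "'a::comm_ring"
  assumes "js \<noteq> []" "\<And>j. j \<in> set js \<Longrightarrow> g j > 0"
  shows "list_product (map (\<lambda>j. list_product (replicate (g j) t)) js)
    = list_product (replicate (sum_list (map g js)) t)"
  using assms
proof (induction js)
  case (Cons j js)
  show ?case
  proof (cases "js = []")
    case False
    have append: "list_product (replicate (a + b) t)
        = list_product (replicate a t) * list_product (replicate b t)" if "a > 0" "b > 0" for a b
      unfolding replicate_add by (rule list_product_append) (use that in auto)
    have "g j > 0" "g (hd js) > 0" using False Cons.prems(2) by auto
    moreover have "g (hd js) \<le> sum_list (map g js)" using False by (cases js) auto
    ultimately have "list_product (replicate (g j + sum_list (map g js)) t)
        = list_product (replicate (g j) t) * list_product (replicate (sum_list (map g js)) t)"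
      by (intro append) auto
    then show ?thesis
      using False Cons.IH Cons.prems(2) by (simp add: list_product_Cons)
  qed simp
qed simp

lemma sum_list_monomial_vars:
  fixes g :: "nat \<Rightarrow> nat"
  shows "sum_list (map g (monomial_vars m))
    = (\<Sum>i\<in>Poly_Mapping.keys m. Poly_Mapping.lookup m i * g i)"
proof -
  have "sum_list (map g (concat (map (\<lambda>i. replicate (Poly_Mapping.lookup m i) i) js)))
      = (\<Sum>i\<in>set js. Poly_Mapping.lookup m i * g i)" if "distinct js" for js
    using that by (induction js) (auto simp: map_concat sum_list_replicate)
  from this[of "sorted_list_of_set (Poly_Mapping.keys m)"] show ?thesis
    by (simp add: monomial_vars_def)
qed

text \<open>
  Uniqueness of base $B$ digits: the reason why weights $B^i$ separate monomials.
\<close>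

lemma digits_unique:
  fixes a b :: "nat \<Rightarrow> nat"
  assumes "\<And>i. i < N \<Longrightarrow> a i < B" "\<And>i. i < N \<Longrightarrow> b i < B"
    "(\<Sum>i<N. a i * B ^ i) = (\<Sum>i<N. b i * B ^ i)" "i < N"
  shows "a i = b i"
  using assms
proof (induction N arbitrary: a b i)
  case (Suc N)
  have split: "(\<Sum>i<Suc N. c i * B ^ i) = c 0 + B * (\<Sum>i<N. c (Suc i) * B ^ i)" for c :: "nat \<Rightarrow> nat"
    by (simp add: sum.lessThan_Suc_shift sum_distrib_left algebra_simps del: sum.lessThan_Suc)
  have B: "a 0 < B" "b 0 < B" using Suc.prems by auto
  have eq: "a 0 + B * (\<Sum>i<N. a (Suc i) * B ^ i) = b 0 + B * (\<Sum>i<N. b (Suc i) * B ^ i)"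
    using Suc.prems(3) split by metis
  have 0: "a 0 = b 0"
    using arg_cong[OF eq, of "\<lambda>x. x mod B"] B by simp
  then have "(\<Sum>i<N. a (Suc i) * B ^ i) = (\<Sum>i<N. b (Suc i) * B ^ i)"
    using eq B by auto
  then have "a (Suc j) = b (Suc j)" if "j < N" for j
    using Suc.IH[of "\<lambda>i. a (Suc i)" "\<lambda>i. b (Suc i)" j] Suc.prems(1,2) that by auto
  then show ?case using 0 Suc.prems(4) by (cases i) auto
qed simp

section \<open>Polynomials and generated subalgebras\<close>

lemma polys_in_mono: "n \<le> n' \<Longrightarrow> polys_in n \<subseteq> polys_in n'"
  unfolding polys_in_def by fastforce

lemma multipoly_in_polys_in:
  obtains n where "P \<in> polys_in n"
proof -
  have "finite (\<Union>m\<in>Poly_Mapping.keys P. Poly_Mapping.keys m)" by simp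
  then obtain n where "(\<Union>m\<in>Poly_Mapping.keys P. Poly_Mapping.keys m) \<subseteq> {..<n}"
    by (meson finite_nat_bounded)
  then show ?thesis by (intro that[of n]) (simp add: polys_in_def UN_subset_iff)
qed

lemma eval_poly_cong:
  assumes "P \<in> polys_in n" "\<And>i. i < n \<Longrightarrow> y i = z i"
  shows "eval_poly smul P y = eval_poly smul P z"
  unfolding eval_poly_def
proof (rule sum.cong[OF refl])
  fix m assume "m \<in> Poly_Mapping.keys P - {0}"
  then have "y i = z i" if "i \<in> Poly_Mapping.keys m" for i
    using assms that by (auto simp: polys_in_def)
  then show "smul (Poly_Mapping.lookup P m) (eval_monomial y m)
      = smul (Poly_Mapping.lookup P m) (eval_monomial z m)"
    by (metis eval_monomial_cong)
qed

text \<open>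
  Reading a polynomial in the variable $t_0$ lets statements in one variable be deduced from those
  in several variables.
\<close>

definition univariate :: "'k::comm_monoid_add poly \<Rightarrow> 'k multipoly" where
  "univariate P = (\<Sum>i\<le>degree P. Poly_Mapping.single (Poly_Mapping.single 0 i) (coeff P i))"

lemma lookup_univariate: "Poly_Mapping.lookup (univariate P) (Poly_Mapping.single 0 i) = coeff P i"
proof -
  have "Poly_Mapping.lookup (univariate P) (Poly_Mapping.single 0 i)
      = (\<Sum>j\<le>degree P. if i = j then coeff P j else 0)"
    unfolding univariate_def lookup_sum
    by (intro sum.cong refl) (auto simp: lookup_single when_def inj_eq[OF inj_single])
  then show ?thesis by (auto simp: coeff_eq_0)
qed

lemma univariate_in_polys_in: "univariate P \<in> polys_in (Suc 0)"
proof -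
  have "Poly_Mapping.keys (univariate P) \<subseteq> (\<Union>i. {Poly_Mapping.single 0 i})"
    unfolding univariate_def using keys_sum by (fastforce split: if_splits)
  then have "Poly_Mapping.keys m \<subseteq> {0}" if "m \<in> Poly_Mapping.keys (univariate P)" for m
    using that by (auto split: if_splits)
  then show ?thesis by (auto simp: polys_in_def)
qed

lemma univariate_eq_0_iff: "univariate P = 0 \<longleftrightarrow> P = 0"
proof
  assume "univariate P = 0"
  then show "P = 0" using lookup_univariate[of P] by (intro poly_eqI) simp
qed (simp add: univariate_def)

lemma const_term_univariate: "const_term (univariate P) = poly P 0"
  using lookup_univariate[of P 0] by (simp add: poly_0_coeff_0)

text \<open>
  The subalgebra generated by the $y_i$ with $i \in V$, described with the numbering of the
  variables fixed by $y$. In \<^const>\<open>alg_generated\<close> the generators may be renumbered and repeated for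
  each element, which makes sums and products awkward; here they correspond to sums and products of
  polynomials.
\<close>

definition poly_values ::
    "('k::field \<Rightarrow> 'a::comm_ring \<Rightarrow> 'a) \<Rightarrow> nat set \<Rightarrow> (nat \<Rightarrow> 'a) \<Rightarrow> 'a set" where
  "poly_values smul V y = {eval_poly smul P y | P.
     const_term P = 0 \<and> (\<forall>m\<in>Poly_Mapping.keys P. Poly_Mapping.keys m \<subseteq> V)}"

context comm_F_algebra
begin

lemma smul_mult_right: "x * smul c y = smul c (x * y)"
  by (metis mult.commute smul_mult_left)

lemma eval_poly_superset:
  assumes "finite S" "Poly_Mapping.keys P - {0} \<subseteq> S" "0 \<notin> S"
  shows "eval_poly smul P y = (\<Sum>m\<in>S. smul (Poly_Mapping.lookup P m) (eval_monomial y m))"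
  unfolding eval_poly_def
  by (rule sum.mono_neutral_left) (use assms in \<open>auto simp: in_keys_iff\<close>)

lemma eval_poly_0 [simp]: "eval_poly smul 0 y = 0"
  by (simp add: eval_poly_def)

lemma eval_poly_add: "eval_poly smul (P + Q) y = eval_poly smul P y + eval_poly smul Q y"
proof -
  define S where "S = Poly_Mapping.keys P \<union> Poly_Mapping.keys Q - {0}"
  have "finite S" "0 \<notin> S" by (auto simp: S_def)
  then have "eval_poly smul R y = (\<Sum>m\<in>S. smul (Poly_Mapping.lookup R m) (eval_monomial y m))"
    if "Poly_Mapping.keys R - {0} \<subseteq> S" for R
    using eval_poly_superset that by blast
  moreover have "Poly_Mapping.keys (P + Q) - {0} \<subseteq> S" "Poly_Mapping.keys P - {0} \<subseteq> S"
    "Poly_Mapping.keys Q - {0} \<subseteq> S"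
    using keys_add[of P Q] by (auto simp: S_def)
  ultimately show ?thesis
    by (simp add: lookup_add scale_left_distrib sum.distrib)
qed

lemma eval_poly_sum: "eval_poly smul (\<Sum>i\<in>I. P i) y = (\<Sum>i\<in>I. eval_poly smul (P i) y)"
  by (induction I rule: infinite_finite_induct) (simp_all add: eval_poly_add)

lemma eval_poly_scale:
  "eval_poly smul (Poly_Mapping.map ((*) c) P) y = smul c (eval_poly smul P y)"
proof -
  have "Poly_Mapping.keys (Poly_Mapping.map ((*) c) P) - {0} \<subseteq> Poly_Mapping.keys P - {0}"
    by (auto simp: in_keys_iff map.rep_eq when_def)
  then have "eval_poly smul (Poly_Mapping.map ((*) c) P) y
      = (\<Sum>m\<in>Poly_Mapping.keys P - {0}.
          smul (Poly_Mapping.lookup (Poly_Mapping.map ((*) c) P) m) (eval_monomial y m))"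
    by (intro eval_poly_superset) auto
  also have "\<dots> = (\<Sum>m\<in>Poly_Mapping.keys P - {0}.
      smul c (smul (Poly_Mapping.lookup P m) (eval_monomial y m)))"
    by (intro sum.cong) (auto simp: map.rep_eq when_def)
  finally show ?thesis by (simp add: eval_poly_def scale_sum_right)
qed

lemma eval_poly_single:
  "m \<noteq> 0 \<Longrightarrow> eval_poly smul (Poly_Mapping.single m c) y = smul c (eval_monomial y m)"
  by (auto simp: eval_poly_def)

lemma eval_poly_single_0 [simp]: "eval_poly smul (Poly_Mapping.single 0 c) y = 0"
  by (auto simp: eval_poly_def)

lemma eval_poly_univariate: "eval_poly smul (univariate P) y = eval_poly1 smul P (y 0)"
proof -
  have "eval_poly smul (univariate P) y
      = (\<Sum>i\<le>degree P. eval_poly smul (Poly_Mapping.single (Poly_Mapping.single 0 i) (coeff P i)) y)"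
    by (simp add: univariate_def eval_poly_sum)
  also have "\<dots> = (\<Sum>i=1..degree P. eval_poly smul (Poly_Mapping.single (Poly_Mapping.single 0 i) (coeff P i)) y)"
    by (rule sum.mono_neutral_right) (auto simp: Suc_le_eq)
  also have "\<dots> = eval_poly1 smul P (y 0)"
    unfolding eval_poly1_def
    by (intro sum.cong refl)
      (auto simp: eval_poly_single eval_monomial_single keys_eq_empty[symmetric] simp del: keys_eq_empty)
  finally show ?thesis .
qed

lemma poly_values_subset_subalgebra:
  assumes A: "subalgebra smul A" and y: "\<And>i. i \<in> V \<Longrightarrow> y i \<in> A"
  shows "poly_values smul V y \<subseteq> A"
proof -
  have sub: "subspace A" and mult: "\<And>a b. a \<in> A \<Longrightarrow> b \<in> A \<Longrightarrow> a * b \<in> A"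
    using A by (auto simp: subalgebra_def)
  have "eval_monomial y m \<in> A" if "m \<noteq> 0" "Poly_Mapping.keys m \<subseteq> V" for m
    unfolding eval_monomial_vars using that y by (intro list_product_in mult) auto
  then show ?thesis
    unfolding poly_values_def eval_poly_def
    by (auto intro!: subspace_sum[OF sub] subspace_scale[OF sub])
qed

lemma monomial_in_poly_values:
  assumes "m \<noteq> 0" "Poly_Mapping.keys m \<subseteq> V"
  shows "eval_monomial y m \<in> poly_values smul V y"
proof -
  have "eval_monomial y m = eval_poly smul (Poly_Mapping.single m 1) y"
    using assms by (simp add: eval_poly_single)
  moreover have "const_term (Poly_Mapping.single m (1::'k)) = 0"
    using assms by (simp add: lookup_single)
  ultimately show ?thesis
    using assms(2) unfolding poly_values_def by fastforce
qed

lemma subspace_poly_values: "subspace (poly_values smul V y)"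
proof (rule subspaceI)
  show "0 \<in> poly_values smul V y"
    unfolding poly_values_def by (intro CollectI exI[of _ 0]) simp
next
  fix a b assume "a \<in> poly_values smul V y" "b \<in> poly_values smul V y"
  then obtain P Q where "a = eval_poly smul P y" "b = eval_poly smul Q y"
    "const_term P = 0" "const_term Q = 0"
    "\<forall>m\<in>Poly_Mapping.keys P. Poly_Mapping.keys m \<subseteq> V"
    "\<forall>m\<in>Poly_Mapping.keys Q. Poly_Mapping.keys m \<subseteq> V"
    unfolding poly_values_def by auto
  moreover have "Poly_Mapping.keys (P + Q) \<subseteq> Poly_Mapping.keys P \<union> Poly_Mapping.keys Q"
    by (rule keys_add)
  ultimately show "a + b \<in> poly_values smul V y"
    unfolding poly_values_def
    by (intro CollectI exI[of _ "P + Q"]) (auto simp: eval_poly_add lookup_add)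
next
  fix c a assume "a \<in> poly_values smul V y"
  then obtain P where "a = eval_poly smul P y" "const_term P = 0"
    "\<forall>m\<in>Poly_Mapping.keys P. Poly_Mapping.keys m \<subseteq> V"
    unfolding poly_values_def by auto
  moreover have "Poly_Mapping.keys (Poly_Mapping.map ((*) c) P) \<subseteq> Poly_Mapping.keys P"
    by (auto simp: in_keys_iff map.rep_eq when_def)
  ultimately show "smul c a \<in> poly_values smul V y"
    unfolding poly_values_def
    by (intro CollectI exI[of _ "Poly_Mapping.map ((*) c) P"])
      (auto simp: eval_poly_scale map.rep_eq when_def)
qed

text \<open>
  By bilinearity, a product of two values is a combination of products of monomials, and these are
  monomials again.
\<close>

lemma subalgebra_poly_values: "subalgebra smul (poly_values smul V y)"
  unfolding subalgebra_def
proof (intro conjI ballI subspace_poly_values)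
  fix a b assume "a \<in> poly_values smul V y" "b \<in> poly_values smul V y"
  then obtain P Q where P: "a = eval_poly smul P y" "\<forall>m\<in>Poly_Mapping.keys P. Poly_Mapping.keys m \<subseteq> V"
    and Q: "b = eval_poly smul Q y" "\<forall>m\<in>Poly_Mapping.keys Q. Poly_Mapping.keys m \<subseteq> V"
    unfolding poly_values_def by auto
  have "smul c (eval_monomial y m) * smul d (eval_monomial y m') \<in> poly_values smul V y"
    if m: "m \<in> Poly_Mapping.keys P - {0}" and m': "m' \<in> Poly_Mapping.keys Q - {0}" for m m' c d
  proof -
    have "m + m' \<noteq> 0"
    proof
      assume "m + m' = 0"
      then have "Poly_Mapping.lookup m i = 0" for i
        by (metis add_is_0 lookup_add lookup_zero)
      then show False using m by (metis Diff_iff insertI1 lookup_zero poly_mapping_eqI)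
    qed
    moreover have "Poly_Mapping.keys (m + m') \<subseteq> V"
      using keys_add[of m m'] P(2) Q(2) m m' by blast
    ultimately have "eval_monomial y (m + m') \<in> poly_values smul V y"
      by (rule monomial_in_poly_values)
    moreover have "smul c (eval_monomial y m) * smul d (eval_monomial y m')
        = smul c (smul d (eval_monomial y (m + m')))"
      using m m' by (simp add: eval_monomial_add smul_mult_left[symmetric] smul_mult_right)
    ultimately show ?thesis
      by (simp only: subspace_scale[OF subspace_poly_values])
  qed
  then show "a * b \<in> poly_values smul V y"
    unfolding P(1) Q(1) eval_poly_def sum_product
    by (intro subspace_sum subspace_poly_values) auto
qed

lemma generator_in_poly_values: "i \<in> V \<Longrightarrow> y i \<in> poly_values smul V y"
  using monomial_in_poly_values[of "Poly_Mapping.single i 1" V y]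
  by (simp add: eval_monomial_single keys_eq_empty[symmetric] del: keys_eq_empty)

lemma poly_values_eq_polys_in: "poly_values smul {..<n} y = {eval_poly smul P y | P. P \<in> polys_in n \<and> const_term P = 0}"
  by (auto simp: poly_values_def polys_in_def)

lemma alg_generated_least:
  assumes "subalgebra smul A" "Y \<subseteq> A"
  shows "alg_generated smul Y \<subseteq> A"
proof
  fix x assume "x \<in> alg_generated smul Y"
  then obtain n y where "y ` {..<n} \<subseteq> Y" "x \<in> poly_values smul {..<n} y"
    unfolding alg_generated_def poly_values_eq_polys_in by auto
  then show "x \<in> A"
    using poly_values_subset_subalgebra[OF assms(1), of "{..<n}" y] assms(2) by auto
qed

lemma subset_alg_generated: "Y \<subseteq> alg_generated smul Y"
proof
  fix x assume "x \<in> Y"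
  moreover have "x \<in> poly_values smul {..<1} (\<lambda>_. x)"
    using generator_in_poly_values[of 0 "{..<1}" "\<lambda>_. x"] by simp
  ultimately show "x \<in> alg_generated smul Y"
    unfolding alg_generated_def poly_values_eq_polys_in by fastforce
qed

text \<open>
  Both sides are the least subalgebra containing all the $y_i$.
\<close>

lemma alg_generated_range: "alg_generated smul (range y) = poly_values smul UNIV y"
proof
  show "alg_generated smul (range y) \<subseteq> poly_values smul UNIV y"
    by (intro alg_generated_least subalgebra_poly_values) (auto intro: generator_in_poly_values)
next
  show "poly_values smul UNIV y \<subseteq> alg_generated smul (range y)"
  proof
    fix x assume "x \<in> poly_values smul UNIV y"
    then obtain P where x: "x = eval_poly smul P y" "const_term P = 0"
      unfolding poly_values_def by auto
    obtain n where "P \<in> polys_in n" by (rule multipoly_in_polys_in)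
    then show "x \<in> alg_generated smul (range y)"
      unfolding alg_generated_def using x by blast
  qed
qed

text \<open>
  Finitely many generators involve only finitely many of the variables, say $t_0, \dots, t_{n-1}$.
  Then $y_n = Q(y_0, \dots, y_{n-1})$ for some $Q$, and $t_n - Q$ is a nontrivial relation.
\<close>

lemma free_sequence_not_finitely_generated:
  assumes indep: "\<And>P. P \<noteq> 0 \<Longrightarrow> const_term P = 0 \<Longrightarrow> eval_poly smul P y \<noteq> 0"
  shows "\<not> finitely_generated smul (alg_generated smul (range y))"
proof
  assume "finitely_generated smul (alg_generated smul (range y))"
  then obtain Z where Z: "finite Z" "alg_generated smul (range y) = alg_generated smul Z"
    unfolding finitely_generated_def by auto
  have "\<exists>n. z \<in> poly_values smul {..<n} y" if "z \<in> Z" for z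
  proof -
    have "z \<in> poly_values smul UNIV y"
      using that Z(2) subset_alg_generated alg_generated_range by blast
    then obtain P where P: "z = eval_poly smul P y" "const_term P = 0"
      unfolding poly_values_def by auto
    obtain n where "P \<in> polys_in n" by (rule multipoly_in_polys_in)
    then show ?thesis
      unfolding poly_values_eq_polys_in using P by auto
  qed
  then obtain N where N: "\<And>z. z \<in> Z \<Longrightarrow> z \<in> poly_values smul {..<N z} y"
    by metis
  define n where "n = Max (insert 0 (N ` Z))"
  have "poly_values smul {..<N z} y \<subseteq> poly_values smul {..<n} y" if "z \<in> Z" for z
  proof -
    have "N z \<le> n" unfolding n_def using Z(1) that by simp
    then show ?thesis unfolding poly_values_eq_polys_in using polys_in_mono by blast
  qed
  then have "Z \<subseteq> poly_values smul {..<n} y" using N by blast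
  then have "alg_generated smul (range y) \<subseteq> poly_values smul {..<n} y"
    unfolding Z(2) by (intro alg_generated_least subalgebra_poly_values)
  then have "y n \<in> poly_values smul {..<n} y"
    using subset_alg_generated by blast
  then obtain Q where Q: "y n = eval_poly smul Q y" "Q \<in> polys_in n" "const_term Q = 0"
    unfolding poly_values_eq_polys_in by auto
  define t where "t = Poly_Mapping.single n (1::nat)"
  have t: "t \<noteq> 0" "Poly_Mapping.keys t = {n}"
    by (auto simp: t_def keys_eq_empty[symmetric] simp del: keys_eq_empty)
  define R where "R = Poly_Mapping.single t 1 + Poly_Mapping.map ((*) (-1)) Q"
  have "t \<notin> Poly_Mapping.keys Q" using Q(2) t(2) unfolding polys_in_def by blast
  then have "Poly_Mapping.lookup R t = 1"
    by (simp add: R_def lookup_add map.rep_eq in_keys_iff)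
  then have "R \<noteq> 0" by auto
  moreover have "const_term R = 0"
    using t(1) Q(3) by (simp add: R_def lookup_add lookup_single map.rep_eq)
  moreover have "eval_poly smul R y = 0"
    using t(1) by (simp add: R_def eval_poly_add eval_poly_scale eval_poly_single Q(1)[symmetric])
      (simp add: t_def eval_monomial_single)
  ultimately show False using indep by blast
qed

text \<open>
  Kronecker substitution: with $B$ larger than all exponents in $P$, the polynomial
  $Q(t) = P(t, t^B, t^{B^2}, \dots)$ in one variable has the same coefficients as $P$, since distinct
  monomials have distinct exponents $w(m) = \sum_i m_i B^i$. So $Q$ is nonzero, and every value of
  $Q$ is a value of $P$.
\<close>

lemma dense_range_univariate_imp_multivariate:
  assumes dense: "\<And>Q. Q \<noteq> 0 \<Longrightarrow> poly Q 0 = 0 \<Longrightarrow> closure (range (eval_poly1 smul Q)) = UNIV"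
    and P: "P \<noteq> 0" "const_term P = 0"
  shows "closure (range (eval_poly smul P)) = UNIV"
proof -
  obtain N where N: "P \<in> polys_in N" by (rule multipoly_in_polys_in)
  obtain B where B: "\<And>m i. m \<in> Poly_Mapping.keys P \<Longrightarrow> i < N \<Longrightarrow> Poly_Mapping.lookup m i < B"
  proof -
    have "finite ((\<lambda>(m, i). Poly_Mapping.lookup m i) ` (Poly_Mapping.keys P \<times> {..<N}))"
      by simp
    then obtain B where "(\<lambda>(m, i). Poly_Mapping.lookup m i) ` (Poly_Mapping.keys P \<times> {..<N}) \<subseteq> {..<B}"
      by (meson finite_nat_bounded)
    then have "\<forall>m\<in>Poly_Mapping.keys P. \<forall>i<N. Poly_Mapping.lookup m i < B"
      by (simp add: image_subset_iff)
    then show thesis using that by blast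
  qed
  \<comment> \<open>The successor makes the base, hence every weight, positive.\<close>
  define B' where "B' = Suc B"
  define w where "w m = (\<Sum>i<N. Poly_Mapping.lookup m i * B' ^ i)" for m :: "nat \<Rightarrow>\<^sub>0 nat"
  have w_sum: "w m = sum_list (map (\<lambda>i. B' ^ i) (monomial_vars m))"
    if "m \<in> Poly_Mapping.keys P" for m
    unfolding w_def sum_list_monomial_vars
    by (rule sum.mono_neutral_right) (use N that in \<open>auto simp: polys_in_def in_keys_iff\<close>)
  have inj: "inj_on w (Poly_Mapping.keys P)"
  proof (rule inj_onI)
    fix m m' assume m: "m \<in> Poly_Mapping.keys P" "m' \<in> Poly_Mapping.keys P" "w m = w m'"
    have "Poly_Mapping.lookup m i = Poly_Mapping.lookup m' i" for i
    proof (cases "i < N")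
      case True
      show ?thesis
        by (rule digits_unique[of N _ B']) (use m B True in \<open>auto simp: B'_def w_def less_Suc_eq\<close>)
    next
      case False
      then have "i \<notin> Poly_Mapping.keys m" "i \<notin> Poly_Mapping.keys m'"
        using N m(1,2) unfolding polys_in_def by blast+
      then show ?thesis by (simp add: in_keys_iff)
    qed
    then show "m = m'" by (rule poly_mapping_eqI)
  qed
  have w_pos: "w m > 0" if m: "m \<in> Poly_Mapping.keys P" for m
  proof -
    have "m \<noteq> 0" using m P(2) by (auto simp: in_keys_iff)
    then have "monomial_vars m \<noteq> []" by simp
    then show ?thesis unfolding w_sum[OF m] by (cases "monomial_vars m") (auto simp: B'_def)
  qed
  define Q where "Q = (\<Sum>m\<in>Poly_Mapping.keys P. monom (Poly_Mapping.lookup P m) (w m))"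
  have coeff_Q: "coeff Q (w m) = Poly_Mapping.lookup P m" if m: "m \<in> Poly_Mapping.keys P" for m
  proof -
    have "coeff Q (w m) = (\<Sum>m'\<in>Poly_Mapping.keys P. if m' = m then Poly_Mapping.lookup P m' else 0)"
      unfolding Q_def coeff_sum coeff_monom
      by (intro sum.cong refl) (use inj m in \<open>auto simp: inj_on_eq_iff\<close>)
    then show ?thesis using m by simp
  qed
  have coeff_Q_0: "coeff Q i = 0" if "i \<notin> w ` Poly_Mapping.keys P" for i
    unfolding Q_def coeff_sum coeff_monom by (rule sum.neutral) (use that in auto)
  have "Q \<noteq> 0"
  proof -
    obtain m where "m \<in> Poly_Mapping.keys P" using P(1) by (metis all_not_in_conv keys_eq_empty)
    then show ?thesis using coeff_Q[of m] by (auto simp: in_keys_iff)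
  qed
  moreover have "poly Q 0 = 0"
    using coeff_Q_0[of 0] w_pos by (force simp: poly_0_coeff_0)
  ultimately have dense_Q: "closure (range (eval_poly1 smul Q)) = UNIV" by (rule dense)
  have "eval_poly1 smul Q x = eval_poly smul P (\<lambda>i. list_product (replicate (B' ^ i) x))" for x
  proof -
    let ?pow = "\<lambda>i. list_product (replicate i x)"
    let ?term = "\<lambda>i. smul (coeff Q i) (?pow i)"
    have "eval_poly1 smul Q x = sum ?term ({1..degree Q} \<union> w ` Poly_Mapping.keys P)"
      unfolding eval_poly1_def
    proof (rule sum.mono_neutral_left)
      show "\<forall>i\<in>{1..degree Q} \<union> w ` Poly_Mapping.keys P - {1..degree Q}. ?term i = 0"
        using w_pos by (force simp: coeff_eq_0)
    qed auto
    also have "\<dots> = sum ?term (w ` Poly_Mapping.keys P)"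
      by (rule sum.mono_neutral_right) (auto simp: coeff_Q_0)
    also have "\<dots> = (\<Sum>m\<in>Poly_Mapping.keys P. smul (Poly_Mapping.lookup P m) (?pow (w m)))"
      by (simp add: sum.reindex[OF inj] coeff_Q)
    also have "\<dots> = (\<Sum>m\<in>Poly_Mapping.keys P - {0}.
        smul (Poly_Mapping.lookup P m) (eval_monomial (\<lambda>i. ?pow (B' ^ i)) m))"
    proof (rule sum.cong)
      show "Poly_Mapping.keys P = Poly_Mapping.keys P - {0}"
        using P(2) by (auto simp: in_keys_iff)
    next
      fix m assume m: "m \<in> Poly_Mapping.keys P - {0}"
      then have "?pow (w m) = eval_monomial (\<lambda>i. ?pow (B' ^ i)) m"
        using list_product_powers[of "monomial_vars m" "\<lambda>i. B' ^ i" x]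
        by (simp add: w_sum eval_monomial_vars B'_def)
      then show "smul (Poly_Mapping.lookup P m) (?pow (w m))
          = smul (Poly_Mapping.lookup P m) (eval_monomial (\<lambda>i. ?pow (B' ^ i)) m)"
        by simp
    qed
    finally show ?thesis unfolding eval_poly_def .
  qed
  then have "range (eval_poly1 smul Q) \<subseteq> range (eval_poly smul P)" by auto
  then show ?thesis using dense_Q closure_mono by blast
qed

end

section \<open>Transitivity and genericity\<close>

lemma funpow_conjugate:
  assumes "\<And>z. \<Phi> (S z) = T (\<Phi> z)"
  shows "\<Phi> ((S ^^ n) x) = (T ^^ n) (\<Phi> x)"
  by (induction n) (simp_all add: assms)

lemma closure_eq_UNIV_iff:
  "closure S = UNIV \<longleftrightarrow> (\<forall>U. open U \<longrightarrow> U \<noteq> {} \<longrightarrow> S \<inter> U \<noteq> {})"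
proof
  assume "closure S = UNIV"
  then show "\<forall>U. open U \<longrightarrow> U \<noteq> {} \<longrightarrow> S \<inter> U \<noteq> {}"
    using open_Int_closure_eq_empty[of _ S] by (auto simp: Int_commute)
next
  assume "\<forall>U. open U \<longrightarrow> U \<noteq> {} \<longrightarrow> S \<inter> U \<noteq> {}"
  moreover have "S \<inter> - closure S = {}" using closure_subset by blast
  ultimately show "closure S = UNIV" by (metis open_Compl closed_closure boolean_algebra.compl_zero double_compl)
qed

lemma hypercyclic_vector_meets:
  assumes "hypercyclic_vector S x" "open V" "V \<noteq> {}"
  obtains n where "(S ^^ n) x \<in> V"
proof -
  have "V \<inter> range (\<lambda>n. (S ^^ n) x) \<noteq> {}"
    using assms unfolding hypercyclic_vector_def closure_eq_UNIV_iff by blast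
  then show ?thesis using that by auto
qed

text \<open>
  A continuous map intertwining $S$ and $T$ sends the dense orbit of $x$ to the orbit of
  $\Phi(x)$, which is therefore dense in the range of $\Phi$.
\<close>

lemma hypercyclic_vector_quasiconjugate:
  assumes hyp: "hypercyclic_vector S x" and cont: "continuous_on UNIV \<Phi>"
    and dense: "closure (range \<Phi>) = UNIV" and comm: "\<And>z. \<Phi> (S z) = T (\<Phi> z)"
  shows "hypercyclic_vector T (\<Phi> x)"
proof -
  have orbit: "\<Phi> ` range (\<lambda>n. (S ^^ n) x) = range (\<lambda>n. (T ^^ n) (\<Phi> x))"
    using funpow_conjugate[of \<Phi> S T, OF comm] by (auto simp: image_iff)
  have "\<Phi> ` closure (range (\<lambda>n. (S ^^ n) x)) \<subseteq> closure (\<Phi> ` range (\<lambda>n. (S ^^ n) x))"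
    by (rule image_closure_subset[OF continuous_on_subset[OF cont subset_UNIV] closed_closure closure_subset])
  then have "closure (range \<Phi>) \<subseteq> closure (range (\<lambda>n. (T ^^ n) (\<Phi> x)))"
    using hyp by (simp add: orbit hypercyclic_vector_def closure_minimal)
  then show ?thesis using dense by (auto simp: hypercyclic_vector_def)
qed

definition topologically_transitive :: "('b::topological_space \<Rightarrow> 'b) \<Rightarrow> bool" where
  "topologically_transitive S \<longleftrightarrow>
     (\<forall>U V. open U \<and> U \<noteq> {} \<and> open V \<and> V \<noteq> {} \<longrightarrow> (\<exists>n. \<exists>x\<in>U. (S ^^ n) x \<in> V))"

text \<open>
  A dense orbit visits $U$ at some time $n$. Without isolated points, removing the finitely many
  earlier orbit points from $V$ leaves a nonempty open set, so $V$ is visited at a time $m \ge n$,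
  and $S^{m-n}$ moves a point of $U$ into $V$.
\<close>

lemma hypercyclic_imp_topologically_transitive:
  fixes S :: "'b::t1_space \<Rightarrow> 'b"
  assumes "hypercyclic S" and no_isolated: "\<And>x::'b. \<not> open {x}"
  shows "topologically_transitive S"
  unfolding topologically_transitive_def
proof (intro allI impI, elim conjE)
  fix U V :: "'b set"
  assume U: "open U" "U \<noteq> {}" and V: "open V" "V \<noteq> {}"
  obtain x where x: "hypercyclic_vector S x" using assms by (auto simp: hypercyclic_def)
  obtain n where n: "(S ^^ n) x \<in> U" using hypercyclic_vector_meets[OF x U] .
  define F where "F = (\<lambda>k. (S ^^ k) x) ` {..<n}"
  have "finite F" by (simp add: F_def)
  have "V - F \<noteq> {}"
  proof
    assume "V - F = {}"
    then have "finite V" using \<open>finite F\<close> by (auto intro: finite_subset)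
    obtain v where "v \<in> V" using V(2) by blast
    then have "{v} = V - (V - {v})" by blast
    moreover have "open (V - (V - {v}))"
      using \<open>finite V\<close> V(1) by (intro open_Diff finite_imp_closed) auto
    ultimately show False using no_isolated by metis
  qed
  moreover have "open (V - F)"
    using V(1) \<open>finite F\<close> by (intro open_Diff finite_imp_closed)
  ultimately obtain m where m: "(S ^^ m) x \<in> V - F"
    using hypercyclic_vector_meets[OF x] by metis
  then have "n \<le> m" by (force simp: F_def)
  then have "(S ^^ (m - n)) ((S ^^ n) x) = (S ^^ m) x"
    by (metis comp_apply funpow_add le_add_diff_inverse2)
  then show "\<exists>n. \<exists>x\<in>U. (S ^^ n) x \<in> V" using n m by (metis DiffD1)
qed

lemma continuous_funpow:
  fixes S :: "'b::topological_space \<Rightarrow> 'b"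
  assumes "continuous_on UNIV S"
  shows "continuous_on UNIV (S ^^ n)"
proof (induction n)
  case (Suc n)
  then show ?case
    using continuous_on_compose[of UNIV "S ^^ n" S] assms continuous_on_subset by (auto simp: comp_def)
qed (simp add: id_def)

lemma funpow_map_prod:
  fixes S :: "'b \<Rightarrow> 'b" and T :: "'c \<Rightarrow> 'c"
  shows "(map_prod S T ^^ n) (x, y) = ((S ^^ n) x, (T ^^ n) y)"
  by (induction n) simp_all

text \<open>
  Furstenberg's theorem: transitivity of $T \times T$ implies transitivity of all finite powers.
  Write $N(A, B)$ for the set of times $k$ with $T^k A \cap B \ne \emptyset$. If
  $n \in N(A, U) \cap N(B, V)$, put $A' = A \cap T^{-n} U$ and $B' = B \cap T^{-n} V$; then
  $N(A', B') \subseteq N(A, B) \cap N(U, V)$ because $T^n$ and $T^k$ commute. So finitely many pairs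
  can be replaced by a single one.
\<close>

lemma simultaneous_return:
  fixes T :: "'b::topological_space \<Rightarrow> 'b" and U V :: "nat \<Rightarrow> 'b set"
  assumes cont: "continuous_on UNIV T" and trans: "topologically_transitive (map_prod T T)"
    and UV: "\<And>i. i < N \<Longrightarrow> open (U i) \<and> U i \<noteq> {} \<and> open (V i) \<and> V i \<noteq> {}"
  shows "\<exists>n. \<forall>i<N. \<exists>x\<in>U i. (T ^^ n) x \<in> V i"
proof -
  have trans2: "\<exists>n. (\<exists>x\<in>A. (T ^^ n) x \<in> B) \<and> (\<exists>y\<in>C. (T ^^ n) y \<in> D)"
    if "open A" "A \<noteq> {}" "open B" "B \<noteq> {}" "open C" "C \<noteq> {}" "open D" "D \<noteq> {}"
    for A B C D :: "'b set"
  proof -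
    have "open (A \<times> C)" "A \<times> C \<noteq> {}" "open (B \<times> D)" "B \<times> D \<noteq> {}"
      using that by (auto intro: open_Times)
    then have "\<exists>n. \<exists>z\<in>A \<times> C. (map_prod T T ^^ n) z \<in> B \<times> D"
      using trans unfolding topologically_transitive_def by meson
    then show ?thesis by (auto simp: funpow_map_prod)
  qed
  have "\<exists>A B. open A \<and> A \<noteq> {} \<and> open B \<and> B \<noteq> {} \<and>
      (\<forall>k. (\<exists>x\<in>A. (T ^^ k) x \<in> B) \<longrightarrow> (\<forall>i<N. \<exists>x\<in>U i. (T ^^ k) x \<in> V i))"
    using UV
  proof (induction N)
    case 0
    show ?case by (intro exI[of _ UNIV]) auto
  next
    case (Suc N)
    then obtain A B where AB: "open A" "A \<noteq> {}" "open B" "B \<noteq> {}"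
      and ret: "\<And>k. \<exists>x\<in>A. (T ^^ k) x \<in> B \<Longrightarrow> \<forall>i<N. \<exists>x\<in>U i. (T ^^ k) x \<in> V i"
      by (metis less_SucI)
    have N: "open (U N)" "U N \<noteq> {}" "open (V N)" "V N \<noteq> {}" using Suc.prems by auto
    obtain n where n: "\<exists>x\<in>A. (T ^^ n) x \<in> U N" "\<exists>y\<in>B. (T ^^ n) y \<in> V N"
      using trans2[OF AB(1,2) N(1,2) AB(3,4) N(3,4)] by blast
    define A' where "A' = A \<inter> (T ^^ n) -` U N"
    define B' where "B' = B \<inter> (T ^^ n) -` V N"
    have "open A'" "open B'"
      unfolding A'_def B'_def
      using AB N continuous_funpow[OF cont] by (auto intro!: open_Int open_vimage)
    moreover have "A' \<noteq> {}" "B' \<noteq> {}" using n by (auto simp: A'_def B'_def)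
    moreover have "\<forall>i<Suc N. \<exists>x\<in>U i. (T ^^ k) x \<in> V i" if k: "\<exists>x\<in>A'. (T ^^ k) x \<in> B'" for k
    proof -
      obtain x where x: "x \<in> A" "(T ^^ n) x \<in> U N" "(T ^^ k) x \<in> B" "(T ^^ n) ((T ^^ k) x) \<in> V N"
        using k by (auto simp: A'_def B'_def)
      have "(T ^^ k) ((T ^^ n) x) = (T ^^ n) ((T ^^ k) x)"
        by (metis add.commute comp_apply funpow_add)
      then have "\<exists>x\<in>U N. (T ^^ k) x \<in> V N" using x by metis
      moreover have "\<forall>i<N. \<exists>x\<in>U i. (T ^^ k) x \<in> V i" using ret x by blast
      ultimately show ?thesis by (auto simp: less_Suc_eq)
    qed
    ultimately show ?case by blast
  qed
  then obtain A B where "open A" "A \<noteq> {}" "open B" "B \<noteq> {}"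
    "\<And>k. \<exists>x\<in>A. (T ^^ k) x \<in> B \<Longrightarrow> \<forall>i<N. \<exists>x\<in>U i. (T ^^ k) x \<in> V i"
    by blast
  then show ?thesis using trans2[of A B A B] by blast
qed

lemma residualI:
  fixes S :: "'b::topological_space set"
  assumes "countable \<U>" "\<And>U. U \<in> \<U> \<Longrightarrow> open U \<and> closure U = UNIV" "\<Inter>\<U> \<subseteq> S"
  shows "residual S"
proof -
  define U where "U = from_nat_into (insert UNIV \<U>)"
  have range: "range U = insert UNIV \<U>"
    unfolding U_def using assms(1) by (intro range_from_nat_into) auto
  have "open (U n) \<and> closure (U n) = UNIV" for n
  proof -
    have "U n \<in> insert UNIV \<U>" using range by blast
    then show ?thesis using assms(2) by auto
  qed
  moreover have "(\<Inter>n. U n) \<subseteq> S" unfolding range using assms(3) by simp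
  ultimately show ?thesis unfolding residual_def by blast
qed

lemma residual_Int:
  assumes "residual S" "residual S'"
  shows "residual (S \<inter> S')"
proof -
  obtain U U' where "\<And>n::nat. open (U n) \<and> closure (U n) = UNIV" "(\<Inter>n. U n) \<subseteq> S"
    "\<And>n::nat. open (U' n) \<and> closure (U' n) = UNIV" "(\<Inter>n. U' n) \<subseteq> S'"
    using assms unfolding residual_def by metis
  then show ?thesis
    by (intro residualI[of "range U \<union> range U'"]) auto
qed

lemma residual_mono: "residual S \<Longrightarrow> S \<subseteq> S' \<Longrightarrow> residual S'"
  unfolding residual_def by (meson subset_trans)

lemma residual_nonempty:
  fixes S :: "'b::complete_space set"
  assumes "residual S"
  shows "S \<noteq> {}"
proof -
  obtain U where U: "\<And>n::nat. open (U n) \<and> closure (U n) = (UNIV::'b set)" "(\<Inter>n. U n) \<subseteq> S"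
    using assms unfolding residual_def by metis
  have "(euclidean :: 'b topology) closure_of \<Inter>(range U) = topspace euclidean"
    by (rule Baire_category) (use U in \<open>auto intro: completely_metrizable_space_euclidean\<close>)
  then show ?thesis using U(2) by auto
qed

text \<open>
  Birkhoff's transitivity theorem. Density of an orbit is tested on the members $B$ of a countable
  $\pi$-base (nonempty open sets refining every nonempty open set), and by transitivity each
  $\bigcup_n S^{-n} B$ is a dense open set.
\<close>

lemma residual_hypercyclic_vectors:
  fixes S :: "'b::topological_space \<Rightarrow> 'b" and \<B> :: "'b set set"
  assumes cont: "continuous_on UNIV S" and trans: "topologically_transitive S"
    and \<B>: "countable \<B>" "\<And>B. B \<in> \<B> \<Longrightarrow> open B \<and> B \<noteq> {}"
      "\<And>U. open U \<Longrightarrow> U \<noteq> {} \<Longrightarrow> \<exists>B\<in>\<B>. B \<subseteq> U"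
  shows "residual {x. hypercyclic_vector S x}"
proof (rule residualI)
  let ?W = "\<lambda>B. \<Union>n. (S ^^ n) -` B"
  show "countable (?W ` \<B>)" using \<B>(1) by simp
  fix W assume "W \<in> ?W ` \<B>"
  then obtain B where B: "B \<in> \<B>" "W = ?W B" by blast
  have "open W"
    unfolding B(2) using \<B>(2)[OF B(1)] continuous_funpow[OF cont] by (auto intro!: open_vimage)
  moreover have "closure W = UNIV"
    unfolding closure_eq_UNIV_iff
  proof (intro allI impI)
    fix U :: "'b set" assume "open U" "U \<noteq> {}"
    then obtain n x where "x \<in> U" "(S ^^ n) x \<in> B"
      using trans \<B>(2)[OF B(1)] unfolding topologically_transitive_def by meson
    then show "W \<inter> U \<noteq> {}" unfolding B(2) by blast
  qed
  ultimately show "open W \<and> closure W = UNIV" by blast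
next
  let ?W = "\<lambda>B. \<Union>n. (S ^^ n) -` B"
  show "\<Inter>(?W ` \<B>) \<subseteq> {x. hypercyclic_vector S x}"
  proof (intro subsetI CollectI)
    fix x assume x: "x \<in> \<Inter>(?W ` \<B>)"
    have "range (\<lambda>n. (S ^^ n) x) \<inter> U \<noteq> {}" if "open U" "U \<noteq> {}" for U
      using \<B>(3)[OF that] x by blast
    then show "hypercyclic_vector S x" by (simp add: hypercyclic_vector_def closure_eq_UNIV_iff)
  qed
qed

lemma separable_countable_pi_base:
  assumes "separable_space (euclidean :: 'b::metric_space topology)"
  obtains \<B> :: "'b::metric_space set set" where "countable \<B>" "\<And>B. B \<in> \<B> \<Longrightarrow> open B \<and> B \<noteq> {}"
    "\<And>U. open U \<Longrightarrow> U \<noteq> {} \<Longrightarrow> \<exists>B\<in>\<B>. B \<subseteq> U"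
proof -
  obtain C :: "'b set" where C: "countable C" "closure C = UNIV"
    using assms by (auto simp: separable_space_def)
  define \<B> where "\<B> = (\<lambda>(c, n). ball c (inverse (Suc n))) ` (C \<times> (UNIV::nat set))"
  show ?thesis
  proof (rule that[of \<B>])
    show "countable \<B>" using C(1) by (simp add: \<B>_def)
    show "open B \<and> B \<noteq> {}" if "B \<in> \<B>" for B using that by (auto simp: \<B>_def)
  next
    fix U :: "'b set" assume "open U" "U \<noteq> {}"
    then obtain x e where x: "x \<in> U" "e > 0" "ball x e \<subseteq> U"
      by (metis equals0I open_contains_ball)
    obtain n where n: "inverse (real (Suc n)) < e / 2"
      using reals_Archimedean[of "e/2"] x(2) by auto
    have "x \<in> closure C" using C(2) by simp
    then obtain c where c: "c \<in> C" "dist c x < inverse (real (Suc n))"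
      by (metis closure_approachable inverse_positive_iff_positive of_nat_0_less_iff zero_less_Suc)
    have "ball c (inverse (Suc n)) \<subseteq> ball x e"
    proof
      fix z assume "z \<in> ball c (inverse (Suc n))"
      then show "z \<in> ball x e"
        using c(2) n dist_triangle[of x z c] by (simp add: dist_commute)
    qed
    then show "\<exists>B\<in>\<B>. B \<subseteq> U" using c(1) x(3) by (auto simp: \<B>_def)
  qed
qed

lemma open_cylinder:
  fixes A :: "nat \<Rightarrow> 'b::topological_space set"
  assumes "\<And>i. i < N \<Longrightarrow> open (A i)"
  shows "open {h. \<forall>i<N. h i \<in> A i}"
proof -
  have "{h. \<forall>i<N. h i \<in> A i} = (\<Inter>i\<in>{..<N}. (\<lambda>h. h i) -` A i)" by auto
  moreover have "open \<dots>" using assms by (intro open_INT ballI open_vimage) auto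
  ultimately show ?thesis by simp
qed

lemma open_contains_cylinder:
  fixes U :: "(nat \<Rightarrow> 'b::topological_space) set"
  assumes "open U" "U \<noteq> {}"
  obtains A N where "\<And>i. open (A i) \<and> A i \<noteq> {}" "{h. \<forall>i<N. h i \<in> A i} \<subseteq> U"
proof -
  obtain h where "h \<in> U" using assms(2) by blast
  moreover have "openin (product_topology (\<lambda>_. euclidean) UNIV) U"
    using assms(1) by (simp add: open_fun_def)
  ultimately obtain A where A: "h \<in> Pi\<^sub>E UNIV A" "\<And>i. open (A i)" "finite {i. A i \<noteq> UNIV}"
    "Pi\<^sub>E UNIV A \<subseteq> U"
    using product_topology_open_contains_basis[of "\<lambda>_. euclidean" UNIV U h] by auto
  obtain N where N: "{i. A i \<noteq> UNIV} \<subseteq> {..<N}" using A(3) by (meson finite_nat_bounded)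
  show ?thesis
  proof (rule that[of A N])
    show "open (A i) \<and> A i \<noteq> {}" for i using A(1,2) by auto
    have "g \<in> Pi\<^sub>E UNIV A" if "\<forall>i<N. g i \<in> A i" for g
    proof -
      have "g i \<in> A i" for i using that N by (cases "i < N") auto
      then show ?thesis by auto
    qed
    then show "{h. \<forall>i<N. h i \<in> A i} \<subseteq> U" using A(4) by blast
  qed
qed

text \<open>
  A cylinder is encoded by the list of sets that restrict its first coordinates, and there are only
  countably many lists over a countable set.
\<close>

lemma cylinder_pi_base:
  fixes \<B> :: "'b::topological_space set set"
  assumes \<B>: "countable \<B>" "\<And>B. B \<in> \<B> \<Longrightarrow> open B \<and> B \<noteq> {}"
    "\<And>U. open U \<Longrightarrow> U \<noteq> {} \<Longrightarrow> \<exists>B\<in>\<B>. B \<subseteq> U"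
  obtains \<C> :: "(nat \<Rightarrow> 'b) set set" where "countable \<C>" "\<And>C. C \<in> \<C> \<Longrightarrow> open C \<and> C \<noteq> {}"
    "\<And>U. open U \<Longrightarrow> U \<noteq> {} \<Longrightarrow> \<exists>C\<in>\<C>. C \<subseteq> U"
proof -
  define cyl :: "'b set list \<Rightarrow> (nat \<Rightarrow> 'b) set"
    where "cyl Bs = {h. \<forall>i<length Bs. h i \<in> Bs ! i}" for Bs
  show ?thesis
  proof (rule that[of "cyl ` lists \<B>"])
    show "countable (cyl ` lists \<B>)" using \<B>(1) by (simp add: countable_lists)
  next
    fix C assume "C \<in> cyl ` lists \<B>"
    then obtain Bs where Bs: "C = cyl Bs" "set Bs \<subseteq> \<B>" by auto
    then have B: "open (Bs ! i) \<and> Bs ! i \<noteq> {}" if "i < length Bs" for i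
      using \<B>(2) that by (meson nth_mem subsetD)
    then have "(\<lambda>i. SOME x. x \<in> Bs ! i) \<in> cyl Bs"
      by (auto simp: cyl_def some_in_eq)
    then show "open C \<and> C \<noteq> {}" using B unfolding Bs(1) by (auto simp: cyl_def intro: open_cylinder)
  next
    fix U :: "(nat \<Rightarrow> 'b) set" assume "open U" "U \<noteq> {}"
    then obtain A N where A: "\<And>i. open (A i) \<and> A i \<noteq> {}" "{h. \<forall>i<N. h i \<in> A i} \<subseteq> U"
      by (rule open_contains_cylinder) blast
    have "\<exists>B\<in>\<B>. B \<subseteq> A i" for i using \<B>(3) A(1)[of i] by blast
    then obtain B where B: "\<And>i. B i \<in> \<B> \<and> B i \<subseteq> A i" by metis
    have "cyl (map B [0..<N]) \<subseteq> {h. \<forall>i<N. h i \<in> A i}" using B by (auto simp: cyl_def)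
    then have "cyl (map B [0..<N]) \<subseteq> U" using A(2) by (rule subset_trans)
    moreover have "map B [0..<N] \<in> lists \<B>" using B by auto
    ultimately show "\<exists>C\<in>cyl ` lists \<B>. C \<subseteq> U" by (rule bexI[OF _ imageI])
  qed
qed

lemma funpow_comp:
  fixes T :: "'b \<Rightarrow> 'b"
  shows "((\<lambda>h. T \<circ> h) ^^ n) h = (T ^^ n) \<circ> h"
  by (induction n) (simp_all add: comp_assoc)

text \<open>
  Cylinders restrict only finitely many coordinates, so transitivity on the space of sequences is
  the simultaneous return property for finitely many pairs of open sets.
\<close>

lemma topologically_transitive_sequences:
  fixes T :: "'b::topological_space \<Rightarrow> 'b"
  assumes "continuous_on UNIV T" "topologically_transitive (map_prod T T)"
  shows "topologically_transitive (\<lambda>h::nat \<Rightarrow> 'b. T \<circ> h)"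
  unfolding topologically_transitive_def
proof (intro allI impI, elim conjE)
  fix U V :: "(nat \<Rightarrow> 'b) set"
  assume U: "open U" "U \<noteq> {}" and V: "open V" "V \<noteq> {}"
  obtain A M where A: "\<And>i. open (A i) \<and> A i \<noteq> {}" "{h. \<forall>i<M. h i \<in> A i} \<subseteq> U"
    using open_contains_cylinder[OF U] by blast
  obtain B N where B: "\<And>i. open (B i) \<and> B i \<noteq> {}" "{h. \<forall>i<N. h i \<in> B i} \<subseteq> V"
    using open_contains_cylinder[OF V] by blast
  obtain n where "\<forall>i<max M N. \<exists>x\<in>A i. (T ^^ n) x \<in> B i"
    using simultaneous_return[OF assms, of "max M N" A B] A(1) B(1) by blast
  then obtain h where h: "\<And>i. i < max M N \<Longrightarrow> h i \<in> A i \<and> (T ^^ n) (h i) \<in> B i"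
    by metis
  then have "h \<in> U" "((\<lambda>h. T \<circ> h) ^^ n) h \<in> V"
    using A(2) B(2) by (auto simp: funpow_comp subset_iff)
  then show "\<exists>n. \<exists>x\<in>U. ((\<lambda>h. T \<circ> h) ^^ n) x \<in> V" by blast
qed

text \<open>
  The $j$-th coordinate of a sequence can be prescribed arbitrarily once $j$ exceeds all
  coordinates restricted by a cylinder; hence meeting a given open set is a dense condition.
\<close>

lemma residual_dense_range:
  assumes "separable_space (euclidean :: 'b::metric_space topology)"
  shows "residual {f :: nat \<Rightarrow> 'b. closure (range f) = UNIV}"
proof -
  obtain \<B> :: "'b set set" where \<B>: "countable \<B>" "\<And>B. B \<in> \<B> \<Longrightarrow> open B \<and> B \<noteq> {}"
    "\<And>U. open U \<Longrightarrow> U \<noteq> {} \<Longrightarrow> \<exists>B\<in>\<B>. B \<subseteq> U"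
    using separable_countable_pi_base[OF assms(1)] by blast
  let ?W = "\<lambda>B. \<Union>j. (\<lambda>f::nat \<Rightarrow> 'b. f j) -` B"
  show ?thesis
  proof (rule residualI)
    show "countable (?W ` \<B>)" using \<B>(1) by simp
  next
    fix W assume "W \<in> ?W ` \<B>"
    then obtain B where B: "open B" "B \<noteq> {}" "W = ?W B" using \<B>(2) by blast
    have "open W" unfolding B(3) using B(1) by (intro open_UN ballI open_vimage) auto
    moreover have "closure W = UNIV"
      unfolding closure_eq_UNIV_iff
    proof (intro allI impI)
      fix U :: "(nat \<Rightarrow> 'b) set" assume "open U" "U \<noteq> {}"
      then obtain A N where A: "\<And>i. open (A i) \<and> A i \<noteq> {}" "{h. \<forall>i<N. h i \<in> A i} \<subseteq> U"
        using open_contains_cylinder by blast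
      obtain b where "b \<in> B" using B(2) by blast
      define h where "h i = (if i < N then SOME x. x \<in> A i else b)" for i
      have "h \<in> U" using A by (auto simp: h_def some_in_eq)
      moreover have "h \<in> W" unfolding B(3) using \<open>b \<in> B\<close> by (auto simp: h_def intro!: exI[of _ N])
      ultimately show "W \<inter> U \<noteq> {}" by blast
    qed
    ultimately show "open W \<and> closure W = UNIV" by blast
  next
    show "\<Inter>(?W ` \<B>) \<subseteq> {f. closure (range f) = UNIV}"
    proof (intro subsetI CollectI)
      fix f assume f: "f \<in> \<Inter>(?W ` \<B>)"
      have "range f \<inter> U \<noteq> {}" if "open U" "U \<noteq> {}" for U
        using \<B>(3)[OF that] f by blast
      then show "closure (range f) = UNIV" by (simp add: closure_eq_UNIV_iff)
    qed
  qed
qed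

lemma residual_hypercyclic_sequences:
  fixes T :: "'b::metric_space \<Rightarrow> 'b"
  assumes sep: "separable_space (euclidean :: 'b topology)"
    and no_isolated: "\<And>a::'b. \<not> open {a}"
    and T: "continuous_on UNIV T" "weakly_mixing T"
  shows "residual {f :: nat \<Rightarrow> 'b. hypercyclic_vector (\<lambda>h. T \<circ> h) f}"
proof -
  obtain \<B> :: "'b set set" where \<B>: "countable \<B>" "\<And>B. B \<in> \<B> \<Longrightarrow> open B \<and> B \<noteq> {}"
    "\<And>U. open U \<Longrightarrow> U \<noteq> {} \<Longrightarrow> \<exists>B\<in>\<B>. B \<subseteq> U"
    using separable_countable_pi_base[OF sep] by blast
  obtain \<C> :: "(nat \<Rightarrow> 'b) set set" where \<C>: "countable \<C>" "\<And>C. C \<in> \<C> \<Longrightarrow> open C \<and> C \<noteq> {}"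
    "\<And>U. open U \<Longrightarrow> U \<noteq> {} \<Longrightarrow> \<exists>C\<in>\<C>. C \<subseteq> U"
    using cylinder_pi_base[OF \<B>] by blast
  have "\<not> open {z}" for z :: "'b \<times> 'b"
  proof
    assume "open {z}"
    then have "open ((\<lambda>x. (x, snd z)) -` {z})"
      by (intro open_vimage continuous_on_Pair) auto
    moreover have "(\<lambda>x. (x, snd z)) -` {z} = {fst z}" by (cases z) auto
    ultimately show False using no_isolated by simp
  qed
  then have "topologically_transitive (map_prod T T)"
    using T(2) unfolding weakly_mixing_def by (intro hypercyclic_imp_topologically_transitive)
  then have "topologically_transitive (\<lambda>h::nat \<Rightarrow> 'b. T \<circ> h)"
    by (rule topologically_transitive_sequences[OF T(1)])
  moreover have "continuous_on UNIV (\<lambda>h::nat \<Rightarrow> 'b. T \<circ> h)"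
    unfolding comp_def
    by (intro continuous_on_coordinatewise_then_product continuous_on_compose2[OF T(1)]) auto
  ultimately show ?thesis using \<C> by (intro residual_hypercyclic_vectors) auto
qed

section \<open>Polynomial maps and hypercyclic sequences\<close>

lemma eval_poly_image_PiE:
  assumes "P \<in> polys_in N"
  shows "eval_poly smul P ` ({..<N} \<rightarrow>\<^sub>E UNIV) = range (eval_poly smul P)"
proof
  show "range (eval_poly smul P) \<subseteq> eval_poly smul P ` ({..<N} \<rightarrow>\<^sub>E UNIV)"
  proof clarify
    fix y
    have "eval_poly smul P y = eval_poly smul P (restrict y {..<N})"
      by (rule eval_poly_cong[OF assms]) simp
    then show "eval_poly smul P y \<in> eval_poly smul P ` ({..<N} \<rightarrow>\<^sub>E UNIV)" by auto
  qed
qed auto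

context comm_F_algebra
begin

lemma continuous_eval_poly: "continuous_on UNIV (eval_poly smul P)"
proof -
  have prod: "continuous_on UNIV (\<lambda>y::nat \<Rightarrow> 'a. list_product (map y js))" for js
  proof (induction js)
    case (Cons j js)
    show ?case
    proof (cases "js = []")
      case False
      have "continuous_on UNIV (\<lambda>y::nat \<Rightarrow> 'a. y j * list_product (map y js))"
        using Cons continuous_on_product_coordinates[of j]
        unfolding continuous_on_def by (auto intro: tendsto_mult)
      then show ?thesis using False by (simp add: list_product_Cons)
    qed simp
  qed (simp add: list_product_def)
  have smul: "continuous_on UNIV (\<lambda>y. smul c (g y))" if "continuous_on UNIV g"
    for c and g :: "(nat \<Rightarrow> 'a) \<Rightarrow> 'a"
  proof -
    have "continuous_on UNIV (\<lambda>y. (c, g y))"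
      using that by (intro continuous_on_Pair continuous_on_const)
    then show ?thesis
      using continuous_on_compose2[OF continuous_smul, of UNIV "\<lambda>y. (c, g y)"] by simp
  qed
  have "continuous_on UNIV (\<lambda>y. \<Sum>m\<in>S. smul (c m) (eval_monomial y m))" for S and c :: "_ \<Rightarrow> 'k"
  proof (induction S rule: infinite_finite_induct)
    case (insert m S)
    then show ?case
      unfolding sum.insert[OF insert(1,2)] eval_monomial_vars
      by (intro continuous_on_add smul prod)
  qed auto
  then show ?thesis unfolding eval_poly_def .
qed

lemma eval_poly_commute:
  assumes "operator smul T" "multiplicative T"
  shows "T (eval_poly smul P y) = eval_poly smul P (T \<circ> y)"
proof -
  interpret T: Vector_Spaces.linear smul smul T
    using assms(1) by (simp add: operator_def)
  have "T (eval_monomial y m) = eval_monomial (T \<circ> y) m" if "m \<noteq> 0" for m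
    using assms(2) that by (intro eval_monomial_hom) (auto simp: multiplicative_def)
  then show ?thesis
    unfolding eval_poly_def T.sum by (intro sum.cong) (auto simp: T.scale)
qed

text \<open>
  Scaling a nonzero vector by factors tending to zero shows that $0$ is not isolated, and
  translations carry this to every point.
\<close>

lemma no_isolated_points:
  assumes "x \<noteq> (0::'a)"
  shows "\<not> open {a::'a}"
proof
  assume "open {a}"
  then have "open ((\<lambda>z. z + a) -` {a})"
    by (intro open_vimage continuous_on_add) auto
  moreover have "(\<lambda>z. z + a) -` {a} = {0}" by auto
  ultimately have "open {0::'a}" by simp
  have "((\<lambda>n. (of_real (inverse (real (Suc n))) :: 'k, x)) \<longlongrightarrow> (of_real 0, x)) sequentially"
    by (intro tendsto_Pair tendsto_of_real LIMSEQ_inverse_real_of_nat tendsto_const)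
  then have "((\<lambda>n. (\<lambda>(c, x). smul c x) (of_real (inverse (real (Suc n))), x))
      \<longlongrightarrow> (\<lambda>(c, x). smul c x) (of_real 0, x)) sequentially"
    by (rule continuous_on_tendsto_compose[OF continuous_smul]) auto
  then have "((\<lambda>n. smul (of_real (inverse (real (Suc n)))) x) \<longlongrightarrow> 0) sequentially"
    by (simp only: prod.case of_real_0 scale_zero_left)
  then have "eventually (\<lambda>n. smul (of_real (inverse (real (Suc n)))) x \<in> {0}) sequentially"
    using \<open>open {0}\<close> by (auto dest: topological_tendstoD)
  then obtain n where "smul (of_real (inverse (real (Suc n)))) x = 0"
    by (auto simp: eventually_sequentially)
  then show False using assms by (simp del: of_nat_Suc)
qed

text \<open>
  The key step. As $T$ is linear and multiplicative, $f \mapsto P(f)$ intertwines $T$ acting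
  coordinatewise on sequences with $T$. If the range of this map is dense, then a single sequence $f$
  with dense orbit under the coordinatewise action has hypercyclic values $P(f)$, with no
  exceptional $P$: this disposes of uncountably many polynomials at once. The injective
  renumbering $g$ of the variables is what algebraic independence of $\{f_i\}$ as a set calls for.
\<close>

lemma hypercyclic_poly_value:
  fixes g :: "nat \<Rightarrow> nat"
  assumes T: "operator smul T" "multiplicative T"
    and dense: "closure (range (eval_poly smul P)) = UNIV"
    and P: "P \<in> polys_in n" and g: "inj_on g {..<n}"
    and f: "hypercyclic_vector (\<lambda>h. T \<circ> h) f"
  shows "hypercyclic_vector T (eval_poly smul P (f \<circ> g))"
proof (rule hypercyclic_vector_quasiconjugate[OF f])
  show "continuous_on UNIV (\<lambda>h. eval_poly smul P (h \<circ> g))"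
    by (rule continuous_on_compose2[OF continuous_eval_poly])
      (auto simp: comp_def intro!: continuous_on_coordinatewise_then_product)
  have "range (eval_poly smul P) \<subseteq> range (\<lambda>h. eval_poly smul P (h \<circ> g))"
  proof clarify
    fix y
    have "eval_poly smul P y = eval_poly smul P ((y \<circ> inv_into {..<n} g) \<circ> g)"
      by (rule eval_poly_cong[OF P]) (use g in simp)
    then show "eval_poly smul P y \<in> range (\<lambda>h. eval_poly smul P (h \<circ> g))" by auto
  qed
  then show "closure (range (\<lambda>h. eval_poly smul P (h \<circ> g))) = UNIV"
    using dense closure_mono by blast
  show "eval_poly smul P ((T \<circ> h) \<circ> g) = T (eval_poly smul P (h \<circ> g))" for h
    by (simp add: eval_poly_commute[OF T] comp_assoc)
qed

lemma operator_funpow_zero: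
  assumes "operator smul T"
  shows "(T ^^ n) 0 = 0"
proof -
  interpret T: Vector_Spaces.linear smul smul T
    using assms by (simp add: operator_def)
  show ?thesis by (induction n) auto
qed

lemma hypercyclic_vector_nonzero:
  assumes "operator smul T" "hypercyclic_vector T f" "x \<noteq> (0::'a)"
  shows "f \<noteq> 0"
proof
  assume "f = 0"
  then have "closure {0::'a} = UNIV"
    using assms(2) operator_funpow_zero[OF assms(1)] by (simp add: hypercyclic_vector_def)
  then show False using assms(3) by auto
qed

text \<open>
  Let $f \ne 0$ lie in the hypercyclic algebra. If $P(f) \ne 0$, it is hypercyclic, and its orbit
  consists of the values $P(T^n f)$. If $P(f) = 0$, then $P$ vanishes on the dense orbit of $f$, hence
  on the whole algebra, contradicting the algebraic independence of any element of $Y$.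
\<close>

lemma hypercyclic_algebra_imp_dense_range:
  assumes indep: "algebraically_independent smul Y" "Y \<noteq> {}"
    and T: "operator smul T" "multiplicative T"
    and A: "hypercyclic_algebra smul T A"
    and P: "P \<noteq> 0" "poly P 0 = 0"
  shows "closure (range (eval_poly1 smul P)) = UNIV"
proof -
  let ?p = "\<lambda>h. eval_poly smul (univariate P) (\<lambda>_. h)"
  have sub: "subalgebra smul A" and hyp: "\<And>f. f \<in> A \<Longrightarrow> f \<noteq> 0 \<Longrightarrow> hypercyclic_vector T f"
    and "A \<noteq> {0}"
    using A by (auto simp: hypercyclic_algebra_def)
  moreover have "0 \<in> A" using sub by (auto simp: subalgebra_def subspace_0)
  ultimately obtain f where f: "f \<in> A" "hypercyclic_vector T f" by blast
  have p_comm: "T (?p h) = ?p (T h)" for h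
    using eval_poly_commute[OF T, of "univariate P" "\<lambda>_. h"] by (simp add: comp_def)
  have p_cont: "continuous_on UNIV ?p"
    by (rule continuous_on_compose2[OF continuous_eval_poly])
      (auto intro!: continuous_on_coordinatewise_then_product)
  have orbit: "(T ^^ n) (?p f) = ?p ((T ^^ n) f)" for n
    using funpow_conjugate[of ?p T T] p_comm by metis
  have "?p f \<in> poly_values smul {..<Suc 0} (\<lambda>_. f)"
    unfolding poly_values_eq_polys_in
    using univariate_in_polys_in[of P] const_term_univariate[of P] P(2) by auto
  then have "?p f \<in> A"
    using poly_values_subset_subalgebra[OF sub, of "{..<Suc 0}" "\<lambda>_. f"] f(1) by auto
  moreover have "?p f \<noteq> 0"
  proof
    assume zero: "?p f = 0"
    \<comment> \<open>Vanishing at $f$ propagates along the orbit, and then to its closure by continuity.\<close>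
    have "range (\<lambda>n. (T ^^ n) f) \<subseteq> {h. ?p h = 0}"
      using orbit zero operator_funpow_zero[OF T(1)] by auto
    moreover have "closed {h. ?p h = 0}"
      using p_cont by (intro closed_Collect_eq) auto
    ultimately have "?p h = 0" for h
      using f(2) closure_minimal unfolding hypercyclic_vector_def by blast
    moreover obtain y where "y \<in> Y" using indep(2) by blast
    moreover have "inj_on (\<lambda>_. y) {..<Suc 0}" by (simp add: inj_on_def)
    ultimately show False
      using indep(1) univariate_in_polys_in[of P] univariate_eq_0_iff[of P] const_term_univariate[of P] P
      unfolding algebraically_independent_def by (metis image_subset_iff)
  qed
  ultimately have "hypercyclic_vector T (?p f)" by (rule hyp)
  moreover have "range (\<lambda>n. (T ^^ n) (?p f)) \<subseteq> range ?p" using orbit by auto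
  ultimately have "closure (range ?p) = UNIV"
    unfolding hypercyclic_vector_def using closure_mono by blast
  then show ?thesis by (simp add: eval_poly_univariate)
qed

lemma freely_generates_of_hypercyclic_sequence:
  assumes nonzero: "x \<noteq> (0::'a)"
    and T: "operator smul T" "multiplicative T"
    and dense: "\<And>P. P \<noteq> 0 \<Longrightarrow> const_term P = 0 \<Longrightarrow> closure (range (eval_poly smul P)) = UNIV"
    and f: "hypercyclic_vector (\<lambda>h. T \<circ> h) f" "closure (range f) = UNIV"
  shows "freely_generates_dense_hypercyclic_algebra smul T f"
proof -
  have hyp: "hypercyclic_vector T (eval_poly smul P f)" if "P \<noteq> 0" "const_term P = 0" for P
  proof -
    obtain n where n: "P \<in> polys_in n" by (rule multipoly_in_polys_in)
    show ?thesis
      using hypercyclic_poly_value[OF T dense[OF that] n inj_on_id f(1)] by simp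
  qed
  have free: "eval_poly smul P f \<noteq> 0" if "P \<noteq> 0" "const_term P = 0" for P
    using hypercyclic_vector_nonzero[OF T(1) hyp[OF that] nonzero] .
  let ?A = "alg_generated smul (range f)"
  have "closure ?A = UNIV"
    using closure_mono[OF subset_alg_generated[of "range f"]] f(2) by auto
  moreover have "hypercyclic_algebra smul T ?A"
    unfolding hypercyclic_algebra_def
  proof (intro conjI ballI)
    show "subalgebra smul ?A" unfolding alg_generated_range by (rule subalgebra_poly_values)
    show "?A \<noteq> {0}" using \<open>closure ?A = UNIV\<close> nonzero by auto
    fix a assume "a \<in> ?A - {0}"
    then obtain P where "a = eval_poly smul P f" "const_term P = 0" "a \<noteq> 0"
      unfolding alg_generated_range poly_values_def by auto
    moreover from this have "P \<noteq> 0" by auto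
    ultimately show "hypercyclic_vector T a" using hyp[of P] by simp
  qed
  ultimately show ?thesis
    unfolding freely_generates_dense_hypercyclic_algebra_def using free by blast
qed

text \<open>
  Distinct elements of the range of $f$ have the form $f_{g(0)}, \dots, f_{g(n-1)}$ with $g$
  injective, so that a polynomial in them is a polynomial in a renumbering of $f$.
\<close>

lemma algebraically_independent_hypercyclic_sequence:
  fixes f :: "nat \<Rightarrow> 'a"
  assumes nonzero: "x \<noteq> (0::'a)"
    and T: "operator smul T" "multiplicative T"
    and dense: "\<And>P. P \<noteq> 0 \<Longrightarrow> const_term P = 0 \<Longrightarrow> closure (range (eval_poly smul P)) = UNIV"
    and f: "hypercyclic_vector (\<lambda>h. T \<circ> h) f"
  shows "algebraically_independent smul (range f)"
  unfolding algebraically_independent_def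
proof (intro allI impI, elim conjE)
  fix n y and P :: "'k multipoly"
  assume y: "inj_on y {..<n}" "y ` {..<n} \<subseteq> range f"
    and P: "P \<in> polys_in n" "P \<noteq> 0" "const_term P = 0"
  define g where "g = inv f \<circ> y"
  have fg: "f (g i) = y i" if "i < n" for i
    using y(2) that by (auto simp: g_def f_inv_into_f image_subset_iff)
  have g: "inj_on g {..<n}"
    using y(1) fg by (metis (no_types, lifting) inj_on_def lessThan_iff)
  have "hypercyclic_vector T (eval_poly smul P (f \<circ> g))"
    by (rule hypercyclic_poly_value[OF T dense[OF P(2,3)] P(1) g f])
  moreover have "eval_poly smul P (f \<circ> g) = eval_poly smul P y"
    by (rule eval_poly_cong[OF P(1)]) (simp add: fg)
  ultimately show "eval_poly smul P y \<noteq> 0"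
    using hypercyclic_vector_nonzero[OF T(1) _ nonzero] by metis
qed

text \<open>
  If $f_i = f_j$ with $i \ne j$, then $t_i - t_j$ is a nontrivial relation.
\<close>

lemma free_sequence_inj:
  assumes "\<And>P. P \<noteq> 0 \<Longrightarrow> const_term P = 0 \<Longrightarrow> eval_poly smul P f \<noteq> 0"
  shows "inj f"
proof (rule injI, rule ccontr)
  fix i j assume eq: "f i = f j" "i \<noteq> j"
  let ?t = "\<lambda>i. Poly_Mapping.single i (1::nat)"
  have t: "?t i \<noteq> 0" "?t j \<noteq> 0" "?t i \<noteq> ?t j"
    using eq(2) by (auto simp: keys_eq_empty[symmetric] dest: arg_cong[of _ _ Poly_Mapping.keys] simp del: keys_eq_empty)
  define P where "P = Poly_Mapping.single (?t i) (1::'k) + Poly_Mapping.single (?t j) (-1)"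
  have "Poly_Mapping.lookup P (?t i) = 1"
    using t by (simp add: P_def lookup_add lookup_single)
  then have "P \<noteq> 0" by auto
  moreover have "const_term P = 0" using t by (simp add: P_def lookup_add lookup_single)
  moreover have "eval_poly smul P f = 0"
    using t eq(1) by (simp add: P_def eval_poly_add eval_poly_single eval_monomial_single)
  ultimately show False using assms by blast
qed

end

section \<open>Equivalence of the conditions\<close>

theorem theorem1p6:
  fixes smul :: "'k::real_or_complex_field \<Rightarrow>
      'a::{comm_ring, topological_semigroup_mult, uniform_topological_group_add, complete_space} \<Rightarrow> 'a"
  assumes "comm_F_algebra smul"
    and "separable_space (euclidean :: 'a topology)"
    and "supports_dense_freely_generated_subalgebra smul"
  shows
    "(\<forall>T. operator smul T \<and> weakly_mixing T \<and> multiplicative T \<longrightarrow>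
        (let a = supports_hypercyclic_algebra smul T;
             b = (\<forall>P. P \<noteq> 0 \<and> poly P 0 = 0 \<longrightarrow> closure (range (eval_poly1 smul P)) = UNIV);
             c = (\<forall>N\<ge>2. \<forall>P\<in>polys_in N. P \<noteq> 0 \<and> const_term P = 0 \<longrightarrow>
                    closure (eval_poly smul P ` ({..<N} \<rightarrow>\<^sub>E UNIV)) = UNIV);
             d = (densely_strongly_algebrable smul {f. hypercyclic_vector T f} \<and>
                  residual {f :: nat \<Rightarrow> 'a. freely_generates_dense_hypercyclic_algebra smul T f})
         in (a \<longleftrightarrow> b) \<and> (b \<longleftrightarrow> c) \<and> (c \<longleftrightarrow> d))) \<and>
     ((\<forall>T. operator smul T \<and> weakly_mixing T \<and> multiplicative T \<longrightarrow>
         (\<exists>A. hypercyclic_algebra smul T A \<and> closure A = UNIV \<and> \<not> finitely_generated smul A)) \<or>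
      (\<forall>T. operator smul T \<and> weakly_mixing T \<and> multiplicative T \<longrightarrow>
         \<not> supports_hypercyclic_algebra smul T))"
proof -
  interpret comm_F_algebra smul by fact
  obtain Y where Y: "algebraically_independent smul Y" "Y \<noteq> {}"
    using assms(3) by (auto simp: supports_dense_freely_generated_subalgebra_def)
  obtain x :: 'a where x: "x \<noteq> 0"
  proof -
    obtain y where "y \<in> Y" using Y(2) by blast
    moreover have "eval_poly smul (univariate [:0, 1:]) (\<lambda>_. y) \<noteq> 0"
      using Y(1) \<open>y \<in> Y\<close> univariate_in_polys_in[of "[:0, 1::'k:]"]
        univariate_eq_0_iff[of "[:0, 1::'k:]"] const_term_univariate[of "[:0, 1::'k:]"]
      unfolding algebraically_independent_def
      by (elim allE[of _ "Suc 0"] allE[of _ "\<lambda>_. y"]) (auto simp: inj_on_def)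
    ultimately show thesis using that by blast
  qed
  \<comment> \<open>The polynomial conditions do not mention the operator, which yields the concluding
    dichotomy.\<close>
  define b where "b \<longleftrightarrow> (\<forall>P. P \<noteq> 0 \<and> poly P 0 = 0 \<longrightarrow> closure (range (eval_poly1 smul P)) = UNIV)"
  define c where "c \<longleftrightarrow> (\<forall>N\<ge>2. \<forall>P\<in>polys_in N. P \<noteq> 0 \<and> const_term P = 0 \<longrightarrow>
      closure (eval_poly smul P ` ({..<N} \<rightarrow>\<^sub>E UNIV)) = UNIV)"
  define d where "d T \<longleftrightarrow> densely_strongly_algebrable smul {f. hypercyclic_vector T f} \<and>
      residual {f :: nat \<Rightarrow> 'a. freely_generates_dense_hypercyclic_algebra smul T f}" for T
  have bc: "c" if "b"
    unfolding c_def
    using dense_range_univariate_imp_multivariate that by (simp add: b_def eval_poly_image_PiE)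
  have cb: "b" if "c"
    unfolding b_def
  proof (intro allI impI, elim conjE)
    fix P :: "'k poly" assume P: "P \<noteq> 0" "poly P 0 = 0"
    have P2: "univariate P \<in> polys_in 2"
      using univariate_in_polys_in polys_in_mono[of "Suc 0" 2] by fastforce
    have "closure (eval_poly smul (univariate P) ` ({..<2} \<rightarrow>\<^sub>E UNIV)) = UNIV"
      using that P P2 univariate_eq_0_iff[of P] const_term_univariate[of P]
      unfolding c_def by (metis order_refl)
    then have "closure (range (eval_poly smul (univariate P))) = UNIV"
      by (simp only: eval_poly_image_PiE[OF P2])
    moreover have "range (eval_poly smul (univariate P)) \<subseteq> range (eval_poly1 smul P)"
      by (auto simp: eval_poly_univariate)
    ultimately show "closure (range (eval_poly1 smul P)) = UNIV"
      using closure_mono by blast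
  qed
  have ab: "b" if "operator smul T" "multiplicative T" "supports_hypercyclic_algebra smul T" for T
    using hypercyclic_algebra_imp_dense_range[OF Y that(1,2)] that(3)
    by (auto simp: b_def supports_hypercyclic_algebra_def)
  have bd: "d T" if T: "operator smul T" "weakly_mixing T" "multiplicative T" and b for T
  proof -
    have dense: "closure (range (eval_poly smul P)) = UNIV" if "P \<noteq> 0" "const_term P = 0" for P
      using dense_range_univariate_imp_multivariate that \<open>b\<close> by (simp add: b_def)
    let ?H = "{f :: nat \<Rightarrow> 'a. hypercyclic_vector (\<lambda>h. T \<circ> h) f} \<inter> {f. closure (range f) = UNIV}"
    have H: "residual ?H"
      using T by (intro residual_Int residual_dense_range residual_hypercyclic_sequences assms(2)
          no_isolated_points[OF x]) (auto simp: operator_def)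
    have gen: "freely_generates_dense_hypercyclic_algebra smul T f" if "f \<in> ?H" for f
      using freely_generates_of_hypercyclic_sequence[OF x T(1,3) dense] that by blast
    obtain f where f: "f \<in> ?H" using residual_nonempty[OF H] by blast
    have free: "eval_poly smul P f \<noteq> 0" if "P \<noteq> 0" "const_term P = 0" for P
      using gen[OF f] that multipoly_in_polys_in[of P]
      unfolding freely_generates_dense_hypercyclic_algebra_def by metis
    have "densely_strongly_algebrable smul {f. hypercyclic_vector T f}"
      unfolding densely_strongly_algebrable_def
    proof (intro exI conjI)
      show "infinite (range f)" using free_sequence_inj[OF free] by (simp add: range_inj_infinite)
      show "algebraically_independent smul (range f)"
        using algebraically_independent_hypercyclic_sequence[OF x T(1,3) dense] f by blast
      show "closure (alg_generated smul (range f)) = UNIV"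
        "alg_generated smul (range f) \<subseteq> {f. hypercyclic_vector T f} \<union> {0}"
        using gen[OF f]
        by (auto simp: freely_generates_dense_hypercyclic_algebra_def hypercyclic_algebra_def)
    qed
    moreover have "residual {f. freely_generates_dense_hypercyclic_algebra smul T f}"
      using H by (rule residual_mono) (use gen in blast)
    ultimately show ?thesis by (simp add: d_def)
  qed
  have d_alg: "\<exists>A. hypercyclic_algebra smul T A \<and> closure A = UNIV \<and> \<not> finitely_generated smul A"
    if "d T" for T
  proof -
    obtain f where f: "freely_generates_dense_hypercyclic_algebra smul T f"
      using \<open>d T\<close> residual_nonempty[of "{f :: nat \<Rightarrow> 'a. freely_generates_dense_hypercyclic_algebra smul T f}"]
      unfolding d_def by blast
    have "eval_poly smul P f \<noteq> 0" if "P \<noteq> 0" "const_term P = 0" for P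
      using f that multipoly_in_polys_in[of P]
      unfolding freely_generates_dense_hypercyclic_algebra_def by metis
    then have "\<not> finitely_generated smul (alg_generated smul (range f))"
      by (rule free_sequence_not_finitely_generated)
    then show ?thesis using f by (auto simp: freely_generates_dense_hypercyclic_algebra_def)
  qed
  then have da: "supports_hypercyclic_algebra smul T" if "d T" for T
    using that by (auto simp: supports_hypercyclic_algebra_def)
  have "(supports_hypercyclic_algebra smul T \<longleftrightarrow> b) \<and> (b \<longleftrightarrow> c) \<and> (c \<longleftrightarrow> d T)"
    if "operator smul T" "weakly_mixing T" "multiplicative T" for T
    using ab[OF that(1,3)] bc cb bd[OF that] da by blast
  moreover have "(\<forall>T. operator smul T \<and> weakly_mixing T \<and> multiplicative T \<longrightarrow>
         (\<exists>A. hypercyclic_algebra smul T A \<and> closure A = UNIV \<and> \<not> finitely_generated smul A)) \<or>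
      (\<forall>T. operator smul T \<and> weakly_mixing T \<and> multiplicative T \<longrightarrow>
         \<not> supports_hypercyclic_algebra smul T)"
    using ab bd d_alg by blast
  ultimately show ?thesis
    unfolding Let_def b_def[symmetric] c_def[symmetric] d_def[symmetric] by blast
qed

end
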